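(* Let $N$ be an integer of the form $4M$ or $8M$ where $M$ is odd and square-free. Then every meromorphic modular function $f$ of integral weight on $\Gamma_0(N)$ with a cuspidal divisor is an $\eta$-quotient of level $N$, i.e. there exist complex numbers $c$ and $(a_t)_{t\mid N}$ with $f=c\prod_{t\mid N}(\eta|V_t)^{a_t}$.
   Context: A meromorphic modular function of integral weight $k$ on $\Gamma_0(N)=\{\left(\begin{smallmatrix}a&b\\c&d\end{smallmatrix}\right)\in\mathrm{SL}_2(\mathbf{Z}):N\mid c\}$ is a meromorphic function $f$ on the upper half-plane $\mathcal{H}$ with $f\!\left(\frac{a\tau+b}{c\tau+d}\right)=(c\tau+d)^k f(\tau)$ for all such matrices, meromorphic at the cusps. It has a cuspidal divisor if it has no zeros or poles in $\mathcal{H}$. $\eta(\tau)=q^{1/24}\prod_{n\ge1}(1-q^n)$ with $q=e^{2\pi i\tau}$, $(\eta|V_t)(\tau)=\eta(t\tau)$, and complex powers are taken via the principal branch of the logarithm. *)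

theory Defs
  imports "HOL-Complex_Analysis.Complex_Analysis" "HOL-Computational_Algebra.Squarefree"
begin

definition upper_half_plane :: "complex set" where
  "upper_half_plane = {\<tau>. Im \<tau> > 0}"

text \<open>The quadruple \<open>(a, b, c, d)\<close> stands for the matrix with rows \<open>(a, b)\<close> and \<open>(c, d)\<close>.\<close>

type_synonym int_mat2 = "int \<times> int \<times> int \<times> int"

definition SL2Z :: "int_mat2 set" where
  "SL2Z = {(a, b, c, d). a * d - b * c = 1}"

definition Gamma0 :: "nat \<Rightarrow> int_mat2 set" where
  "Gamma0 N = {(a, b, c, d). (a, b, c, d) \<in> SL2Z \<and> int N dvd c}"

fun moebius :: "int_mat2 \<Rightarrow> complex \<Rightarrow> complex" where
  "moebius (a, b, c, d) \<tau> = (of_int a * \<tau> + of_int b) / (of_int c * \<tau> + of_int d)"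

fun automorphy :: "int_mat2 \<Rightarrow> complex \<Rightarrow> complex" where
  "automorphy (a, b, c, d) \<tau> = of_int c * \<tau> + of_int d"

definition slash :: "int \<Rightarrow> (complex \<Rightarrow> complex) \<Rightarrow> int_mat2 \<Rightarrow> complex \<Rightarrow> complex" where
  "slash k f \<gamma> \<tau> = automorphy \<gamma> \<tau> powi (- k) * f (moebius \<gamma> \<tau>)"

text \<open>
  Every cusp is \<open>\<gamma> \<infinity>\<close> for some \<open>\<gamma>\<close> in the full modular group. If \<open>f\<close> is modular of weight \<open>k\<close>
  on \<open>\<Gamma>\<^sub>0(N)\<close>, then \<open>slash k f \<gamma>\<close> has period \<open>N\<close>, because \<open>\<Gamma>\<^sub>0(N)\<close> contains the principal
  congruence subgroup of level \<open>N\<close>, which is normal. Near \<open>i\<infinity>\<close> it is therefore a function of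
  \<open>exp (2 \<pi> i \<tau> / N)\<close> whichever the width of the cusp, and that function has to be meromorphic
  at the origin.
\<close>

definition meromorphic_at_cusps :: "nat \<Rightarrow> int \<Rightarrow> (complex \<Rightarrow> complex) \<Rightarrow> bool" where
  "meromorphic_at_cusps N k f \<longleftrightarrow>
     (\<forall>\<gamma>\<in>SL2Z. \<exists>g y\<^sub>0. g meromorphic_on {0} \<and>
        (\<forall>\<tau>\<in>upper_half_plane. Im \<tau> > y\<^sub>0 \<longrightarrow>
           slash k f \<gamma> \<tau> = g (exp (2 * of_real pi * \<i> * \<tau> / of_nat N))))"

text \<open>
  Functions are total, so a meromorphic function carries some value at each of its poles and
  could carry a wrong value at a removable singularity. The predicate \<open>nicely_meromorphic_on\<close> of
  the library assigns 0 at the poles (which is compatible with the modularity equation)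
  and forces continuity everywhere else.
\<close>

definition meromorphic_modular :: "nat \<Rightarrow> int \<Rightarrow> (complex \<Rightarrow> complex) \<Rightarrow> bool" where
  "meromorphic_modular N k f \<longleftrightarrow>
     f nicely_meromorphic_on upper_half_plane \<and>
     (\<forall>\<gamma>\<in>Gamma0 N. \<forall>\<tau>\<in>upper_half_plane. f (moebius \<gamma> \<tau>) = automorphy \<gamma> \<tau> powi k * f \<tau>) \<and>
     meromorphic_at_cusps N k f"

definition cuspidal_divisor :: "(complex \<Rightarrow> complex) \<Rightarrow> bool" where
  "cuspidal_divisor f \<longleftrightarrow> (\<forall>\<tau>\<in>upper_half_plane. \<not> is_pole f \<tau> \<and> f \<tau> \<noteq> 0)"

definition nome :: "complex \<Rightarrow> complex" where
  "nome \<tau> = exp (2 * of_real pi * \<i> * \<tau>)"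

text \<open>
  As usual, \<open>q\<^sup>s\<close> means \<open>exp (2 \<pi> i s \<tau>)\<close>. This is not the principal power of the
  number \<open>nome \<tau>\<close>, which is discontinuous in \<open>\<tau>\<close>.
\<close>

definition dedekind_eta :: "complex \<Rightarrow> complex" where
  "dedekind_eta \<tau> = exp (2 * of_real pi * \<i> * \<tau> / 24) * (\<Prod>n. 1 - nome \<tau> ^ Suc n)"

text \<open>
  The complex power \<open>\<eta>\<^sup>a\<close>, with the principal branch of the logarithm taken in each
  factor \<open>1 - q\<^sup>n\<close> of the product. These factors lie in the right half-plane, so that the
  result is holomorphic. (The principal logarithm of the number \<open>\<eta> \<tau>\<close> itself jumps, as the
  argument of \<open>\<eta> \<tau>\<close> is unbounded on the upper half-plane.) The lemmas below show that this is
  \<open>exp (a L)\<close> for the holomorphic logarithm \<open>L\<close> of \<open>\<eta>\<close> that equals \<open>Ln \<eta>\<close> on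
  the imaginary axis, and that powers with integer exponents are the ordinary ones. Any
  other holomorphic logarithm of \<open>\<eta>\<close> changes \<open>\<eta>\<^sup>a\<close> by a constant factor only.
\<close>

definition eta_powr :: "complex \<Rightarrow> complex \<Rightarrow> complex" where
  "eta_powr a \<tau> =
     exp (2 * of_real pi * \<i> * a * \<tau> / 24) * (\<Prod>n. (1 - nome \<tau> ^ Suc n) powr a)"

definition V_op :: "nat \<Rightarrow> (complex \<Rightarrow> complex) \<Rightarrow> complex \<Rightarrow> complex" where
  "V_op t g \<tau> = g (of_nat t * \<tau>)"

text \<open>Note that \<open>(\<eta>|V\<^sub>t)\<^sup>a = (\<eta>\<^sup>a)|V\<^sub>t\<close>.\<close>

definition eta_quotient :: "nat \<Rightarrow> (complex \<Rightarrow> complex) \<Rightarrow> bool" where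
  "eta_quotient N f \<longleftrightarrow>
     (\<exists>(c :: complex) (a :: nat \<Rightarrow> complex). \<forall>\<tau>\<in>upper_half_plane.
        f \<tau> = c * (\<Prod>t | t dvd N. V_op t (eta_powr (a t)) \<tau>))"


definition ln_eta :: "complex \<Rightarrow> complex" where
  "ln_eta \<tau> = 2 * of_real pi * \<i> * \<tau> / 24 + (\<Sum>n. Ln (1 - nome \<tau> ^ Suc n))"

lemma norm_nome: "norm (nome \<tau>) = exp (- (2 * pi * Im \<tau>))"
  by (simp add: nome_def)

lemma norm_nome_less_1: "\<tau> \<in> upper_half_plane \<Longrightarrow> norm (nome \<tau>) < 1"
  by (simp add: norm_nome upper_half_plane_def)

lemma one_minus_nome_power_nz:
  assumes "\<tau> \<in> upper_half_plane"
  shows "1 - nome \<tau> ^ Suc n \<noteq> 0"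
proof
  assume "1 - nome \<tau> ^ Suc n = 0"
  hence "norm (nome \<tau>) ^ Suc n = 1"
    by (metis eq_iff_diff_eq_0 norm_one norm_power)
  moreover have "norm (nome \<tau>) ^ Suc n < 1"
    by (intro power_Suc_less_one norm_nome_less_1 assms) (simp add: norm_nome)
  ultimately show False by simp
qed

lemma uniform_limit_ln_eta:
  assumes "y > 0"
  shows "uniform_limit {\<tau>. Im \<tau> \<ge> y} (\<lambda>N \<tau>. \<Sum>n<N. Ln (1 - nome \<tau> ^ Suc n))
           (\<lambda>\<tau>. \<Sum>n. Ln (1 - nome \<tau> ^ Suc n)) sequentially"
proof (rule Weierstrass_m_test_ev)
  define r where "r = exp (- (2 * pi * y))"
  have r: "0 < r" "r < 1"
    using assms by (auto simp: r_def)
  show "summable (\<lambda>n. 2 * r ^ Suc n)"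
    using r by (simp add: summable_mult)
  have "(\<lambda>n. r ^ Suc n) \<longlonglongrightarrow> 0"
    using LIMSEQ_Suc[OF LIMSEQ_power_zero[of r]] r by simp
  hence "eventually (\<lambda>n. r ^ Suc n < 1 / 2) sequentially"
    by (rule order_tendstoD) auto
  thus "\<forall>\<^sub>F n in sequentially. \<forall>\<tau>\<in>{\<tau>. Im \<tau> \<ge> y}.
          norm (Ln (1 - nome \<tau> ^ Suc n)) \<le> 2 * r ^ Suc n"
  proof eventually_elim
    case (elim n)
    show ?case
    proof
      fix \<tau> assume "\<tau> \<in> {\<tau>. Im \<tau> \<ge> y}"
      hence "norm (nome \<tau>) \<le> r"
        by (auto simp: norm_nome r_def)
      hence le: "norm (nome \<tau> ^ Suc n) \<le> r ^ Suc n"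
        unfolding norm_power by (intro power_mono) auto
      have "norm (Ln (1 + (- (nome \<tau> ^ Suc n)))) \<le> 2 * norm (- (nome \<tau> ^ Suc n))"
        by (rule norm_Ln_le) (use le elim in simp)
      also have "\<dots> \<le> 2 * r ^ Suc n"
        using le by simp
      finally show "norm (Ln (1 - nome \<tau> ^ Suc n)) \<le> 2 * r ^ Suc n"
        by simp
    qed
  qed
qed

lemma sums_ln_eta:
  assumes "\<tau> \<in> upper_half_plane"
  shows "(\<lambda>n. Ln (1 - nome \<tau> ^ Suc n)) sums (\<Sum>n. Ln (1 - nome \<tau> ^ Suc n))"
  using tendsto_uniform_limitI[OF uniform_limit_ln_eta[of "Im \<tau>"], of \<tau>] assms
  by (auto simp: sums_def upper_half_plane_def)

lemma eta_powr_eq_exp: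
  assumes "\<tau> \<in> upper_half_plane"
  shows "eta_powr a \<tau> = exp (a * ln_eta \<tau>)"
proof -
  have "(\<lambda>n. a * Ln (1 - nome \<tau> ^ Suc n)) sums (a * (\<Sum>n. Ln (1 - nome \<tau> ^ Suc n)))"
    by (intro sums_mult sums_ln_eta assms)
  moreover have "(1 - nome \<tau> ^ Suc n) powr a = exp (a * Ln (1 - nome \<tau> ^ Suc n))" for n
    using one_minus_nome_power_nz[OF assms, of n] by (simp only: powr_def if_False)
  ultimately have "(\<lambda>n. (1 - nome \<tau> ^ Suc n) powr a) has_prod exp (a * (\<Sum>n. Ln (1 - nome \<tau> ^ Suc n)))"
    unfolding has_prod_def by (simp only: sums_imp_has_prod_exp simp_thms)
  hence "(\<Prod>n. (1 - nome \<tau> ^ Suc n) powr a) = exp (a * (\<Sum>n. Ln (1 - nome \<tau> ^ Suc n)))"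
    by (simp only: has_prod_iff)
  thus ?thesis
    unfolding eta_powr_def ln_eta_def ring_distribs exp_add
    by (simp add: mult_ac del: power_Suc)
qed

lemma eta_powr_1:
  assumes "\<tau> \<in> upper_half_plane"
  shows "eta_powr 1 \<tau> = dedekind_eta \<tau>"
  using one_minus_nome_power_nz[OF assms] by (simp add: eta_powr_def dedekind_eta_def)

lemma exp_ln_eta: "\<tau> \<in> upper_half_plane \<Longrightarrow> exp (ln_eta \<tau>) = dedekind_eta \<tau>"
  using eta_powr_1 eta_powr_eq_exp[of \<tau> 1] by simp

lemma eta_powr_of_int:
  assumes "\<tau> \<in> upper_half_plane"
  shows "eta_powr (of_int m) \<tau> = dedekind_eta \<tau> powi m"
  unfolding eta_powr_eq_exp[OF assms] exp_ln_eta[OF assms, symmetric]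
  by (simp add: exp_power_int mult.commute)

lemma holomorphic_nome: "nome holomorphic_on A"
  unfolding nome_def by (intro holomorphic_intros)

lemma holomorphic_ln_eta: "ln_eta holomorphic_on upper_half_plane"
proof -
  have op: "open upper_half_plane"
    unfolding upper_half_plane_def by (rule open_halfspace_Im_gt)
  have nonpos: "1 - nome \<tau> ^ Suc n \<notin> \<real>\<^sub>\<le>\<^sub>0" if "\<tau> \<in> upper_half_plane" for \<tau> n
  proof -
    have "Re (nome \<tau> ^ Suc n) \<le> norm (nome \<tau>) ^ Suc n"
      by (metis complex_Re_le_cmod norm_power)
    also have "\<dots> < 1"
      by (intro power_Suc_less_one norm_nome_less_1 that) (simp add: norm_nome)
    finally show ?thesis
      by (auto simp: complex_nonpos_Reals_iff)
  qed
  have "(\<lambda>\<tau>. \<Sum>n. Ln (1 - nome \<tau> ^ Suc n)) holomorphic_on upper_half_plane"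
  proof (rule holomorphic_uniform_sequence[OF op])
    show "(\<lambda>\<tau>. \<Sum>n<N. Ln (1 - nome \<tau> ^ Suc n)) holomorphic_on upper_half_plane" for N
      by (intro holomorphic_intros holomorphic_nome nonpos)
  next
    fix \<tau> assume \<tau>: "\<tau> \<in> upper_half_plane"
    define d where "d = Im \<tau> / 2"
    have d: "d > 0"
      using \<tau> by (simp add: d_def upper_half_plane_def)
    have sub: "cball \<tau> d \<subseteq> {z. Im z \<ge> d}"
    proof
      fix z assume "z \<in> cball \<tau> d"
      hence "\<bar>Im (\<tau> - z)\<bar> \<le> d"
        using abs_Im_le_cmod[of "\<tau> - z"] by (simp add: dist_norm)
      hence "Im \<tau> - Im z \<le> d"
        by simp
      thus "z \<in> {z. Im z \<ge> d}"
        unfolding d_def mem_Collect_eq by linarith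
    qed
    moreover have "{z. Im z \<ge> d} \<subseteq> upper_half_plane"
      using d by (auto simp: upper_half_plane_def)
    ultimately show "\<exists>d>0. cball \<tau> d \<subseteq> upper_half_plane \<and>
        uniform_limit (cball \<tau> d) (\<lambda>N \<tau>. \<Sum>n<N. Ln (1 - nome \<tau> ^ Suc n))
          (\<lambda>\<tau>. \<Sum>n. Ln (1 - nome \<tau> ^ Suc n)) sequentially"
      using d uniform_limit_on_subset[OF uniform_limit_ln_eta[OF d] sub] by blast
  qed
  thus ?thesis
    unfolding ln_eta_def by (intro holomorphic_intros) simp_all
qed

lemma holomorphic_eta_powr: "eta_powr a holomorphic_on upper_half_plane"
proof -
  have "(\<lambda>\<tau>. exp (a * ln_eta \<tau>)) holomorphic_on upper_half_plane"
    by (intro holomorphic_intros holomorphic_ln_eta)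
  thus ?thesis
    by (rule holomorphic_transform) (simp add: eta_powr_eq_exp)
qed

lemma ln_eta_imaginary_axis:
  assumes "y > 0"
  shows "ln_eta (\<i> * of_real y) = Ln (dedekind_eta (\<i> * of_real y))"
proof -
  define \<tau> where "\<tau> = \<i> * of_real y"
  have \<tau>: "\<tau> \<in> upper_half_plane"
    using assms by (simp add: \<tau>_def upper_half_plane_def)
  have nome: "nome \<tau> = of_real (exp (- (2 * pi * y)))"
  proof -
    have "2 * of_real pi * \<i> * \<tau> = of_real (- (2 * pi * y))"
      by (simp add: \<tau>_def)
    thus ?thesis
      unfolding nome_def by (simp only: exp_of_real)
  qed
  have "Ln (1 - nome \<tau> ^ Suc n) \<in> \<real>" for n
  proof -
    have "exp (- (2 * pi * y)) ^ Suc n < 1"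
      using assms by (intro power_Suc_less_one) auto
    hence "Ln (of_real (1 - exp (- (2 * pi * y)) ^ Suc n)) =
             of_real (ln (1 - exp (- (2 * pi * y)) ^ Suc n))"
      by (intro Ln_of_real) (simp del: power_Suc)
    thus ?thesis
      unfolding nome by (metis Reals_of_real of_real_1 of_real_diff of_real_power)
  qed
  hence "\<forall>n. Im (Ln (1 - nome \<tau> ^ Suc n)) = 0"
    by (simp add: complex_is_Real_iff)
  hence "Im (\<Sum>n. Ln (1 - nome \<tau> ^ Suc n)) = 0"
    using sums_Im[OF sums_ln_eta[OF \<tau>]] by (simp add: sums_iff)
  hence "Im (ln_eta \<tau>) = 0"
    by (simp add: ln_eta_def \<tau>_def)
  hence "Ln (exp (ln_eta \<tau>)) = ln_eta \<tau>"
    by (intro Ln_exp) auto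
  thus ?thesis
    using exp_ln_eta[OF \<tau>] by (simp add: \<tau>_def)
qed

lemma eta_powr_imaginary_axis:
  assumes "y > 0"
  shows "eta_powr a (\<i> * of_real y) = dedekind_eta (\<i> * of_real y) powr a"
proof -
  have \<tau>: "\<i> * of_real y \<in> upper_half_plane"
    using assms by (simp add: upper_half_plane_def)
  have "dedekind_eta (\<i> * of_real y) \<noteq> 0"
    by (metis exp_ln_eta[OF \<tau>] exp_not_eq_zero)
  thus ?thesis
    by (simp add: eta_powr_eq_exp[OF \<tau>] ln_eta_imaginary_axis[OF assms] powr_def)
qed

end

theory Submission
  imports Defs
begin

text \<open>
  Each divisor \<open>e\<close> of \<open>N\<close> gives exactly one cusp, because \<open>gcd(e, N/e)\<close> divides 2. The matrix of the orders
  of the functions \<open>\<eta>(t \<tau>)\<close> at these cusps is essentially \<open>(gcd(t, e)\<^sup>2)\<close>, which is invertible (Smith).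
  So there are real exponents for which the quotient \<open>G\<close> of \<open>f\<close> by the \<open>\<eta>\<close>-quotient has order 0 at
  every cusp: then \<open>\<bar>G\<bar> y\<^sup>w\<close> is invariant under \<open>\<Gamma>\<^sub>0(N)\<close> and comparable to \<open>y\<^sup>w\<close> near every cusp. If
  \<open>w \<ge> 0\<close>, it attains a minimum by the Phragmen-Lindeloef principle, and as \<open>log y\<close> is strictly superharmonic this
  forces \<open>w = 0\<close> and \<open>G\<close> constant; if \<open>w < 0\<close>, consider \<open>1/G\<close>.

  Only \<open>\<bar>\<eta>\<bar>\<close> matters, so the inversion formula is needed for absolute values only. It follows from
  Liouville's theorem for the quotient of the Jacobi theta products of \<open>\<tau>\<close> and \<open>-1/\<tau>\<close>, which is a
  constant: its values at 0 and at the half periods determine its modulus.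
\<close>

section \<open>q-Pochhammer symbols\<close>

text \<open>An eta-quotient has one exponent per divisor of \<open>N\<close>, and its growth at a
  cusp depends only on the gcd of the denominator with \<open>N\<close>. It can match
  \<open>f\<close> only if cusps with the same gcd are equivalent, which is what
  \<open>gcd(e, N/e) | 2\<close> secures. The linear system for the exponents is solved over the
  reals, where the multiplier of the eta-quotient is unwieldy. Absolute values remove it: all
  invariance and growth statements concern \<open>ln |G| + w ln y\<close>, which is linear in the
  exponents. Here \<open>w = k/2 - (sum of the exponents)/4\<close> is half the weight of
  \<open>G\<close>, a priori any real number of either sign; its vanishing comes out of the minimum
  argument and replaces a valence formula. The minimum exists although the modular curve is not
  compact: \<open>Gamma0 N\<close> identifies each point with one in finitely many images of the
  region \<open>Im \<tau> \<ge> 1/2\<close>, and on each image the minimum is found on the boundary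
  line, where periodicity leaves a compact segment.\<close>

definition qpoch :: "complex \<Rightarrow> complex \<Rightarrow> complex" where
  "qpoch q w = (\<Prod>n. 1 - w * q ^ n)"

lemma abs_convergent_qpoch:
  fixes q w :: complex
  assumes "norm q < 1"
  shows "abs_convergent_prod (\<lambda>n. 1 - w * q ^ n)"
  unfolding abs_convergent_prod_conv_summable
  using assms by (simp add: norm_mult norm_power summable_mult summable_geometric)

lemma convergent_qpoch:
  fixes q w :: complex
  assumes "norm q < 1"
  shows "convergent_prod (\<lambda>n. 1 - w * q ^ n)"
  by (rule abs_convergent_prod_imp_convergent_prod[OF abs_convergent_qpoch[OF assms]])

lemma qpoch_LIMSEQ:
  assumes "norm q < 1"
  shows "(\<lambda>n. \<Prod>k<n. 1 - w * q ^ k) \<longlonglongrightarrow> qpoch q w"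
  using convergent_prod_LIMSEQ[OF convergent_qpoch[OF assms, of w]]
  unfolding qpoch_def by (subst (asm) lessThan_Suc_atMost [symmetric])
    (rule LIMSEQ_imp_Suc, simp)

lemma qpoch_step:
  assumes "norm q < 1"
  shows "qpoch q w = (1 - w) * qpoch q (q * w)"
proof (rule LIMSEQ_unique)
  show "(\<lambda>n. \<Prod>k<Suc n. 1 - w * q ^ k) \<longlonglongrightarrow> qpoch q w"
    by (rule LIMSEQ_Suc[OF qpoch_LIMSEQ[OF assms]])
  have "(\<Prod>k<Suc n. 1 - w * q ^ k) = (1 - w) * (\<Prod>k<n. 1 - (q * w) * q ^ k)" for n
    by (subst prod.lessThan_Suc_shift) (simp add: mult_ac)
  thus "(\<lambda>n. \<Prod>k<Suc n. 1 - w * q ^ k) \<longlonglongrightarrow> (1 - w) * qpoch q (q * w)"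
    by (simp only:) (intro tendsto_intros qpoch_LIMSEQ assms)
qed

lemma qpoch_nonzero:
  assumes "norm q < 1" and "\<And>n. w * q ^ n \<noteq> 1"
  shows "qpoch q w \<noteq> 0"
  unfolding qpoch_def
  by (rule prodinf_nonzero[OF convergent_qpoch[OF assms(1)]]) (use assms(2) in force)

lemma qpoch_mult_minus:
  assumes "norm q < 1"
  shows "qpoch q w * qpoch q (-w) = qpoch (q\<^sup>2) (w\<^sup>2)"
proof (rule LIMSEQ_unique)
  have q2: "norm (q\<^sup>2) < 1"
    using assms by (simp add: norm_power power_less_one_iff)
  show "(\<lambda>n. \<Prod>k<n. 1 - w\<^sup>2 * (q\<^sup>2) ^ k) \<longlonglongrightarrow> qpoch (q\<^sup>2) (w\<^sup>2)"
    by (rule qpoch_LIMSEQ[OF q2])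
  have "(\<Prod>k<n. 1 - w\<^sup>2 * (q\<^sup>2) ^ k) = (\<Prod>k<n. 1 - w * q ^ k) * (\<Prod>k<n. 1 - (-w) * q ^ k)" for n
    unfolding prod.distrib[symmetric]
    by (intro prod.cong refl) (simp add: algebra_simps power2_eq_square power_mult_distrib)
  thus "(\<lambda>n. \<Prod>k<n. 1 - w\<^sup>2 * (q\<^sup>2) ^ k) \<longlonglongrightarrow> qpoch q w * qpoch q (-w)"
    by (simp only:) (intro tendsto_intros qpoch_LIMSEQ assms)
qed

lemma qpoch_split:
  assumes "norm q < 1"
  shows "qpoch (q\<^sup>2) w * qpoch (q\<^sup>2) (q * w) = qpoch q w"
proof (rule LIMSEQ_unique)
  have q2: "norm (q\<^sup>2) < 1"
    using assms by (simp add: norm_power power_less_one_iff)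
  have "filterlim (\<lambda>n::nat. 2 * n) sequentially sequentially"
    by (rule mult_nat_left_at_top) simp
  from filterlim_compose[OF qpoch_LIMSEQ[OF assms] this]
  show "(\<lambda>n. \<Prod>k<2 * n. 1 - w * q ^ k) \<longlonglongrightarrow> qpoch q w" .
  have "(\<Prod>k<2 * n. 1 - w * q ^ k) =
        (\<Prod>k<n. 1 - w * (q\<^sup>2) ^ k) * (\<Prod>k<n. 1 - q * w * (q\<^sup>2) ^ k)" for n
    by (induction n) (simp_all add: power_mult[symmetric] mult_ac)
  thus "(\<lambda>n. \<Prod>k<2 * n. 1 - w * q ^ k) \<longlonglongrightarrow> qpoch (q\<^sup>2) w * qpoch (q\<^sup>2) (q * w)"
    by (simp only:) (intro tendsto_intros qpoch_LIMSEQ q2)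
qed

lemma holomorphic_qpoch:
  assumes "norm q < 1"
  shows "qpoch q holomorphic_on UNIV"
proof (rule holomorphic_uniform_sequence)
  show "(\<lambda>w. \<Prod>k<n. 1 - w * q ^ k) holomorphic_on UNIV" for n
    by (intro holomorphic_intros)
next
  fix z :: complex
  have "uniformly_convergent_on (cball z 1) (\<lambda>n w. \<Sum>k<n. norm (- (w * q ^ k)))"
  proof (rule Weierstrass_m_test')
    show "summable (\<lambda>k. (norm z + 1) * norm q ^ k)"
      using assms by (intro summable_mult summable_geometric) auto
    fix k w assume "w \<in> cball z 1"
    hence "norm w \<le> norm z + 1"
      by (smt (verit) dist_norm mem_cball norm_minus_commute norm_triangle_ineq2)
    thus "norm (norm (- (w * q ^ k))) \<le> (norm z + 1) * norm q ^ k"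
      by (simp add: norm_mult norm_power mult_right_mono)
  qed
  hence "uniformly_convergent_on (cball z 1) (\<lambda>n w. \<Prod>k<n. 1 + (- (w * q ^ k)))"
    by (intro uniformly_convergent_on_prod) (auto intro!: continuous_intros)
  then obtain l where l: "uniform_limit (cball z 1) (\<lambda>n w. \<Prod>k<n. 1 - w * q ^ k) l sequentially"
    by (auto simp: uniformly_convergent_on_def)
  moreover have "l w = qpoch q w" if "w \<in> cball z 1" for w
    using tendsto_uniform_limitI[OF l that] qpoch_LIMSEQ[OF assms] LIMSEQ_unique by blast
  ultimately have "uniform_limit (cball z 1) (\<lambda>n w. \<Prod>k<n. 1 - w * q ^ k) (qpoch q) sequentially"
    using uniform_limit_cong'[of "cball z 1"] by (smt (verit, best))
  thus "\<exists>d>0. cball z d \<subseteq> UNIV \<and>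
          uniform_limit (cball z d) (\<lambda>n w. \<Prod>k<n. 1 - w * q ^ k) (qpoch q) sequentially"
    by (intro exI[of _ 1]) auto
qed auto

lemma holomorphic_on_qpoch [holomorphic_intros]:
  assumes "norm q < 1" "f holomorphic_on A"
  shows "(\<lambda>z. qpoch q (f z)) holomorphic_on A"
  using holomorphic_on_compose_gen[OF assms(2) holomorphic_qpoch[OF assms(1)]]
  by (simp add: o_def)

lemma dedekind_eta_qpoch: "dedekind_eta \<tau> = exp (2 * of_real pi * \<i> * \<tau> / 24) * qpoch (nome \<tau>) (nome \<tau>)"
  by (simp add: dedekind_eta_def qpoch_def)

text \<open>Euler's identity. Pairing \<open>1 - q^n\<close> with \<open>1 + q^n\<close> and
  splitting into even and odd exponents both produce \<open>qpoch (q\<^sup>2) (q\<^sup>2)\<close>;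
  cancelling \<open>qpoch q q\<close> leaves the claim. It makes the theta values at the half
  periods multiply to something elementary.\<close>

lemma qpoch_euler:
  assumes "norm q < 1" "q \<noteq> 0"
  shows "qpoch q (-q) * qpoch (q\<^sup>2) q = 1"
proof -
  have q2: "norm (q\<^sup>2) < 1"
    using assms by (simp add: norm_power power_less_one_iff)
  have "qpoch q q \<noteq> 0"
  proof (rule qpoch_nonzero[OF assms(1)])
    fix n
    have "norm (q ^ Suc n) < 1"
      using assms by (metis norm_ge_zero norm_power power_Suc_less_one zero_less_norm_iff)
    thus "q * q ^ n \<noteq> 1" by auto
  qed
  moreover have "qpoch q q * (qpoch q (-q) * qpoch (q\<^sup>2) q) = qpoch q q"
    using qpoch_mult_minus[OF assms(1), of q] qpoch_split[OF assms(1), of q]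
    by (metis mult.assoc mult.commute power2_eq_square)
  ultimately show ?thesis
    by simp
qed

section \<open>The Jacobi theta product\<close>

lemma nome_add: "nome (a + b) = nome a * nome b"
  by (simp add: nome_def distrib_left exp_add)

lemma nome_minus: "nome (- a) = inverse (nome a)"
  by (simp add: nome_def exp_minus)

lemma nome_diff: "nome (a - b) = nome a / nome b"
  by (simp add: nome_def right_diff_distrib exp_diff)

lemma nome_nonzero [simp]: "nome a \<noteq> 0"
  by (simp add: nome_def)

lemma nome_eq_1_iff: "nome z = 1 \<longleftrightarrow> z \<in> \<int>"
proof
  assume "nome z = 1"
  then obtain n :: int where "Im z = 0" "2 * pi * Re z = of_int (2 * n) * pi"
    by (auto simp: nome_def exp_eq_1)
  hence "z = of_int n"
    by (simp add: complex_eq_iff)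
  thus "z \<in> \<int>" by simp
next
  assume "z \<in> \<int>"
  then obtain n where "z = of_int n"
    by (elim Ints_cases)
  thus "nome z = 1"
    by (auto simp: nome_def exp_eq_1)
qed

lemma nome_of_int [simp]: "nome (of_int n) = 1" "nome 1 = 1" "nome 0 = 1"
  by (simp_all add: nome_eq_1_iff)

lemma nome_of_nat_mult: "nome (of_nat n * z) = nome z ^ n"
  by (simp add: nome_def exp_of_nat_mult[symmetric] mult_ac)

lemma nome_half: "nome (1 / 2) = - 1"
  by (simp add: nome_def)

text \<open>Jacobi's \<open>theta_1\<close> in product form, without the factors that do not depend
  on \<open>z\<close>. The exponential in front makes it odd.\<close>

definition jtheta :: "complex \<Rightarrow> complex \<Rightarrow> complex" where
  "jtheta \<tau> z = exp (- (of_real pi * \<i> * z)) * qpoch (nome \<tau>) (nome z) * qpoch (nome \<tau>) (nome (\<tau> - z))"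

text \<open>The cofactor of the simple zero of \<open>jtheta\<close> at 0. Its value at 0 is
  \<open>dedekind_eta\<close> squared up to a power of \<open>q\<close>, which is how eta enters the
  theta argument.\<close>

definition jtheta_core :: "complex \<Rightarrow> complex \<Rightarrow> complex" where
  "jtheta_core \<tau> z = qpoch (nome \<tau>) (nome (\<tau> + z)) * qpoch (nome \<tau>) (nome (\<tau> - z))"

lemma holomorphic_jtheta: "\<tau> \<in> upper_half_plane \<Longrightarrow> jtheta \<tau> holomorphic_on UNIV"
  unfolding jtheta_def nome_def[of "_ - _"] nome_def[of z for z]
  using norm_nome_less_1[of \<tau>]
  by (auto intro!: holomorphic_intros simp: nome_def)

lemma holomorphic_jtheta_core: "\<tau> \<in> upper_half_plane \<Longrightarrow> jtheta_core \<tau> holomorphic_on UNIV"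
  unfolding jtheta_core_def nome_def[of "_ - _"] nome_def[of "_ + _"]
  using norm_nome_less_1[of \<tau>]
  by (auto intro!: holomorphic_intros simp: nome_def)

lemma jtheta_eq_core:
  assumes "\<tau> \<in> upper_half_plane"
  shows "jtheta \<tau> z = (exp (- (of_real pi * \<i> * z)) - exp (of_real pi * \<i> * z)) * jtheta_core \<tau> z"
proof -
  have "qpoch (nome \<tau>) (nome z) = (1 - nome z) * qpoch (nome \<tau>) (nome (\<tau> + z))"
    by (subst qpoch_step[OF norm_nome_less_1[OF assms]]) (simp add: nome_add)
  moreover have "exp (- (of_real pi * \<i> * z)) * nome z = exp (of_real pi * \<i> * z)"
    unfolding nome_def exp_add[symmetric] by (rule arg_cong[of _ _ exp]) (simp add: algebra_simps)
  ultimately show ?thesis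
    unfolding jtheta_def jtheta_core_def by (metis mult.assoc mult.right_neutral right_diff_distrib)
qed

lemma jtheta_minus:
  assumes "\<tau> \<in> upper_half_plane"
  shows "jtheta \<tau> (- z) = - jtheta \<tau> z"
  unfolding jtheta_eq_core[OF assms] by (simp add: jtheta_core_def algebra_simps)

lemma jtheta_plus_1: "jtheta \<tau> (z + 1) = - jtheta \<tau> z"
  by (simp add: jtheta_def nome_add nome_diff distrib_left exp_add exp_minus exp_diff)

lemma jtheta_plus_tau:
  assumes "\<tau> \<in> upper_half_plane"
  shows "jtheta \<tau> (z + \<tau>) = - exp (- (of_real pi * \<i> * (\<tau> + 2 * z))) * jtheta \<tau> z"
proof -
  have "qpoch (nome \<tau>) (nome (- z)) = (1 - nome (- z)) * qpoch (nome \<tau>) (nome (\<tau> - z))"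
    by (subst qpoch_step[OF norm_nome_less_1[OF assms]]) (simp add: nome_diff nome_minus field_simps)
  hence "jtheta \<tau> (z + \<tau>) = exp (- (of_real pi * \<i> * (z + \<tau>))) * (1 - nome (- z)) * jtheta_core \<tau> z"
    by (simp add: jtheta_def jtheta_core_def add_ac mult_ac)
  moreover have "exp (- (of_real pi * \<i> * (z + \<tau>))) * (1 - nome (- z)) =
      - exp (- (of_real pi * \<i> * (\<tau> + 2 * z))) *
        (exp (- (of_real pi * \<i> * z)) - exp (of_real pi * \<i> * z))"
    by (simp add: nome_def algebra_simps flip: exp_add)
  ultimately show ?thesis
    unfolding jtheta_eq_core[OF assms] by simp
qed

lemma jtheta_zeroD:
  assumes "\<tau> \<in> upper_half_plane" "jtheta \<tau> z = 0"
  shows "\<exists>m n :: int. z = of_int m + of_int n * \<tau>"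
proof -
  have "\<exists>m n :: int. u = of_int m + of_int n * \<tau>" if "qpoch (nome \<tau>) (nome u) = 0" for u
  proof -
    from that obtain n where "nome u * nome \<tau> ^ n = 1"
      using qpoch_nonzero[OF norm_nome_less_1[OF assms(1)]] by blast
    hence "nome (u + of_nat n * \<tau>) = 1"
      by (simp add: nome_add nome_of_nat_mult)
    then obtain m where "u + of_nat n * \<tau> = of_int m"
      by (auto simp: nome_eq_1_iff elim: Ints_cases)
    hence "u = of_int m + of_int (- int n) * \<tau>"
      by (simp add: algebra_simps)
    thus ?thesis by blast
  qed
  note * = this
  from assms(2) consider "qpoch (nome \<tau>) (nome z) = 0" | "qpoch (nome \<tau>) (nome (\<tau> - z)) = 0"
    by (auto simp: jtheta_def)
  thus ?thesis
  proof cases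
    case 1
    thus ?thesis by (rule *)
  next
    case 2
    from *[OF this] obtain m n :: int where "\<tau> - z = of_int m + of_int n * \<tau>" by blast
    hence "z = of_int (- m) + of_int (1 - n) * \<tau>"
      by (simp add: algebra_simps)
    thus ?thesis by blast
  qed
qed

lemma jtheta_core_0:
  assumes "\<tau> \<in> upper_half_plane"
  shows "jtheta_core \<tau> 0 = qpoch (nome \<tau>) (nome \<tau>) ^ 2" "jtheta_core \<tau> 0 \<noteq> 0"
proof -
  show eq: "jtheta_core \<tau> 0 = qpoch (nome \<tau>) (nome \<tau>) ^ 2"
    by (simp add: jtheta_core_def power2_eq_square)
  have "qpoch (nome \<tau>) (nome \<tau>) \<noteq> 0"
    by (rule qpoch_nonzero[OF norm_nome_less_1[OF assms]])
       (use one_minus_nome_power_nz[OF assms] in auto)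
  thus "jtheta_core \<tau> 0 \<noteq> 0"
    by (simp add: eq)
qed

text \<open>At a half period the two Pochhammer factors agree (at \<open>1/2\<close> after splitting
  off \<open>1 - (-1) = 2\<close>), so each value is an exponential times a square. The three
  squares multiply to the square of Euler's product, which is 1.\<close>

lemma jtheta_half_periods:
  assumes "\<tau> \<in> upper_half_plane"
  shows "jtheta \<tau> (1 / 2) * jtheta \<tau> (\<tau> / 2) * jtheta \<tau> ((1 + \<tau>) / 2) =
           - 2 * exp (- (of_real pi * \<i> * \<tau>))"
proof -
  define q where "q = nome \<tau>"
  define p where "p = nome (\<tau> / 2)"
  have q: "norm q < 1" "q \<noteq> 0"
    using norm_nome_less_1[OF assms] by (auto simp: q_def)
  have pq: "p\<^sup>2 = q"
    by (simp add: p_def q_def power2_eq_square flip: nome_add)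
  have [simp]: "exp (- (of_real pi * \<i> / 2)) = - \<i>"
    using exp_minus[of "of_real pi * \<i> / 2"] cis_minus_pi_half
    by (simp add: cis_conv_exp mult.commute)
  have 1: "jtheta \<tau> (1 / 2) = - \<i> * 2 * qpoch q (- q) ^ 2"
    using qpoch_step[OF q(1), of "-1"]
    by (simp add: jtheta_def nome_diff nome_half power2_eq_square flip: q_def)
  have 2: "jtheta \<tau> (\<tau> / 2) = exp (- (of_real pi * \<i> * \<tau> / 2)) * qpoch q p ^ 2"
    by (simp add: jtheta_def power2_eq_square flip: q_def p_def)
  have "nome ((1 + \<tau>) / 2) = - p"
    unfolding add_divide_distrib nome_add by (simp add: nome_half p_def)
  moreover have "nome (\<tau> - (1 + \<tau>) / 2) = - p"
  proof -
    have "\<tau> - (1 + \<tau>) / 2 = \<tau> / 2 - 1 / 2" by (simp add: field_simps)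
    thus ?thesis by (simp only: nome_diff nome_half p_def) simp
  qed
  moreover have "exp (- (of_real pi * \<i> * ((1 + \<tau>) / 2))) = - \<i> * exp (- (of_real pi * \<i> * \<tau> / 2))"
  proof -
    have "- (of_real pi * \<i> * ((1 + \<tau>) / 2)) = - (of_real pi * \<i> / 2) + - (of_real pi * \<i> * \<tau> / 2)"
      by (simp add: field_simps)
    thus ?thesis by (simp only: exp_add) simp
  qed
  ultimately have 3: "jtheta \<tau> ((1 + \<tau>) / 2) = - \<i> * exp (- (of_real pi * \<i> * \<tau> / 2)) * qpoch q (- p) ^ 2"
    by (simp add: jtheta_def power2_eq_square flip: q_def)
  have "qpoch q p * qpoch q (- p) = qpoch (q\<^sup>2) q"
    using qpoch_mult_minus[OF q(1), of p] by (simp add: pq)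
  hence E: "qpoch q (- q) * (qpoch q p * qpoch q (- p)) = 1"
    using qpoch_euler[OF q] by simp
  have "jtheta \<tau> (1 / 2) * jtheta \<tau> (\<tau> / 2) * jtheta \<tau> ((1 + \<tau>) / 2) =
      - 2 * (exp (- (of_real pi * \<i> * \<tau> / 2)) * exp (- (of_real pi * \<i> * \<tau> / 2))) *
      (qpoch q (- q) * (qpoch q p * qpoch q (- p))) ^ 2"
    unfolding 1 2 3 by (simp add: power_mult_distrib mult_ac)
  also have "exp (- (of_real pi * \<i> * \<tau> / 2)) * exp (- (of_real pi * \<i> * \<tau> / 2)) =
      exp (- (of_real pi * \<i> * \<tau>))"
    by (simp add: mult_ac flip: exp_add)
  finally show ?thesis
    by (simp add: E)
qed

section \<open>Elliptic quotients and the inversion formula for the modulus of eta\<close>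

lemma lattice_reduce:
  assumes "Im \<tau> > 0"
  obtains m n :: int and s t :: real
  where "z = of_real s + of_real t * \<tau> + of_int m + of_int n * \<tau>" "\<bar>s\<bar> \<le> 1/2" "\<bar>t\<bar> \<le> 1/2"
proof -
  define y where "y = Im z / Im \<tau>"
  define x where "x = Re z - y * Re \<tau>"
  have z: "z = of_real x + of_real y * \<tau>"
    using assms by (simp add: complex_eq_iff x_def y_def)
  show ?thesis
  proof (rule that[of "x - of_int (round x)" "y - of_int (round y)" "round x" "round y"])
    show "\<bar>x - of_int (round x)\<bar> \<le> 1/2" "\<bar>y - of_int (round y)\<bar> \<le> 1/2"
      using of_int_round_abs_le[of x] of_int_round_abs_le[of y] by (simp_all add: abs_minus_commute)
  qed (simp add: z algebra_simps)
qed

text \<open>The quotient is doubly periodic and can be singular only at lattice points, all of which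
  look like 0, where it has a limit. Hence it is bounded, its singularities are removable, and
  Liouville's theorem applies.\<close>

lemma elliptic_quotient_constant:
  fixes num den :: "complex \<Rightarrow> complex"
  assumes \<tau>: "Im \<tau> > 0"
    and num: "num holomorphic_on UNIV" and den: "den holomorphic_on UNIV"
    and zero: "\<And>z. den z = 0 \<Longrightarrow> \<exists>m n :: int. z = of_int m + of_int n * \<tau>"
    and per1: "\<And>z. num (z + 1) / den (z + 1) = num z / den z"
    and per2: "\<And>z. num (z + \<tau>) / den (z + \<tau>) = num z / den z"
    and lim: "((\<lambda>z. num z / den z) \<longlongrightarrow> L) (at 0)"
    and z: "den z \<noteq> 0"
  shows "num z = L * den z"
proof -
  define F where "F = (\<lambda>z. num z / den z)"
  \<comment> \<open>The period parallelogram is centred at 0, so that 0 is the only lattice point in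
    it: coordinates of absolute value at most 1/2 that are integers vanish.\<close>
  define Q where "Q = (\<lambda>(s, t). complex_of_real s + of_real t * \<tau>) ` ({-1/2..1/2} \<times> {-1/2..1/2})"
  have "compact Q"
    unfolding Q_def
    by (intro compact_continuous_image compact_Times)
       (auto simp: case_prod_unfold intro!: continuous_intros)
  have Q_zero: "w = 0" if "w \<in> Q" "den w = 0" for w
  proof -
    from zero[OF that(2)] obtain m n :: int where mn: "w = of_int m + of_int n * \<tau>" by blast
    from that(1) obtain s t where st: "w = of_real s + of_real t * \<tau>" "\<bar>s\<bar> \<le> 1/2" "\<bar>t\<bar> \<le> 1/2"
      by (auto simp: Q_def)
    have "of_int n * Im \<tau> = t * Im \<tau>"
      using arg_cong[OF mn, of Im] arg_cong[OF st(1), of Im] by (simp only: plus_complex.sel Im_complex_of_real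
        times_complex.sel) auto
    hence "t = of_int n" using \<tau> by simp
    moreover from this have "s = of_int m"
      using arg_cong[OF mn, of Re] arg_cong[OF st(1), of Re] by simp
    ultimately have "\<bar>real_of_int n\<bar> < 1" "\<bar>real_of_int m\<bar> < 1"
      using st(2,3) by linarith+
    hence "m = 0" "n = 0" by linarith+
    thus "w = 0" by (simp add: mn)
  qed
  have "continuous_on Q (F(0 := L))"
  proof (rule continuous_at_imp_continuous_on, rule ballI)
    fix w assume w: "w \<in> Q"
    show "isCont (F(0 := L)) w"
    proof (cases "w = 0")
      case True
      have "((F(0 := L)) \<longlongrightarrow> L) (at 0)"
        using lim unfolding F_def
        by (rule Lim_transform_eventually) (auto simp: eventually_at_filter)
      thus ?thesis by (simp add: isCont_def True)
    next
      case False
      hence "den w \<noteq> 0" using Q_zero w by blast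
      moreover have "isCont num w" "isCont den w"
        using num den by (auto simp: holomorphic_on_imp_continuous_on continuous_on_eq_continuous_at
            intro!: continuous_on_interior[OF holomorphic_on_imp_continuous_on])
      ultimately have "isCont F w"
        unfolding F_def by (intro continuous_intros)
      moreover have "eventually (\<lambda>x. x \<noteq> 0) (nhds w)"
        using False by (rule t1_space_nhds)
      hence "eventually (\<lambda>x. F x = (F(0 := L)) x) (nhds w)"
        by eventually_elim auto
      ultimately show ?thesis
        using isCont_cong by blast
    qed
  qed
  hence "bounded ((F(0 := L)) ` Q)"
    using \<open>compact Q\<close> compact_continuous_image compact_imp_bounded by blast
  then obtain B0 where B0: "\<And>w. w \<in> Q \<Longrightarrow> norm ((F(0 := L)) w) \<le> B0"
    unfolding bounded_iff by (metis imageI)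
  \<comment> \<open>Functions are total, so \<open>F 0\<close> has a value (0 if
    \<open>den 0 = 0\<close>) that may differ from \<open>L\<close>; the bound has to cover it
    too.\<close>
  define B where "B = max B0 (norm (F 0))"
  have QB: "norm (F w) \<le> B" if "w \<in> Q" for w
    using B0[OF that] by (cases "w = 0") (auto simp: B_def max_def)
  have F1: "F (w + of_nat n) = F w" for w n
    by (induction n) (use per1 in \<open>simp_all add: F_def add.assoc[symmetric] add.commute[of 1]\<close>)
  have F1': "F (w + of_int n) = F w" for w n
    using F1[of w "nat n"] F1[of "w + of_int n" "nat (- n)"] by (cases "n \<ge> 0") auto
  have F2: "F (w + of_nat n * \<tau>) = F w" for w n
  proof (induction n)
    case (Suc n)
    show ?case using Suc per2[of "w + of_nat n * \<tau>"] by (simp add: F_def algebra_simps)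
  qed auto
  have F2': "F (w + of_int n * \<tau>) = F w" for w n
    using F2[of w "nat n"] F2[of "w + of_int n * \<tau>" "nat (- n)"] by (cases "n \<ge> 0") auto
  have FB: "norm (F w) \<le> B" for w
  proof -
    obtain m n :: int and s t :: real where
      w: "w = of_real s + of_real t * \<tau> + of_int m + of_int n * \<tau>" "\<bar>s\<bar> \<le> 1/2" "\<bar>t\<bar> \<le> 1/2"
      by (rule lattice_reduce[OF \<tau>, of w])
    have "of_real s + of_real t * \<tau> \<in> Q"
    proof -
      have "-1/2 \<le> s" "s \<le> 1/2" "-1/2 \<le> t" "t \<le> 1/2"
        using w(2,3) by linarith+
      thus ?thesis
        unfolding Q_def by (intro image_eqI[of _ _ "(s, t)"]) simp_all
    qed
    moreover have "F w = F (of_real s + of_real t * \<tau>)"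
      by (simp only: w(1) F1' F2')
    ultimately show ?thesis
      using QB by simp
  qed
  have "num analytic_on UNIV" "den analytic_on UNIV"
    using num den by (simp_all add: analytic_on_open)
  hence mero: "F meromorphic_on UNIV"
    unfolding F_def by (intro meromorphic_intros analytic_on_imp_meromorphic_on)
  define H where "H = remove_sings F"
  have H: "H analytic_on {w} \<and> norm (H w) \<le> B" for w
  proof -
    have iso: "isolated_singularity_at F w" and ness: "not_essential F w"
      using mero by (auto intro: meromorphic_on_isolated_singularity meromorphic_on_not_essential
        meromorphic_on_subset)
    have "\<not> is_pole F w"
    proof
      assume "is_pole F w"
      hence "eventually (\<lambda>x. norm (F x) > B) (at w)"
        unfolding is_pole_def filterlim_at_infinity_conv_norm_at_top filterlim_at_top_dense by blast
      then obtain x where "norm (F x) > B"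
        using eventually_happens by (metis trivial_limit_at)
      thus False using FB[of x] by simp
    qed
    with ness obtain c where c: "F \<midarrow>w\<rightarrow> c"
      by (auto simp: not_essential_def)
    have "norm c \<le> B"
      by (rule tendsto_upperbound[OF tendsto_norm[OF c]]) (simp_all add: FB)
    thus ?thesis
      using remove_sings_analytic_at[OF iso c] remove_sings_eqI[OF c] by (simp add: H_def)
  qed
  hence "H analytic_on UNIV"
    using analytic_on_analytic_at by blast
  moreover have "bounded (range H)"
    using H by (auto simp: bounded_iff)
  ultimately have "H constant_on UNIV"
    by (intro Liouville_theorem) (auto intro: analytic_imp_holomorphic)
  then obtain c where c: "\<And>w. H w = c"
    by (auto simp: constant_on_def)
  have "H 0 = L"
    unfolding H_def by (rule remove_sings_eqI) (use lim in \<open>simp add: F_def\<close>)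
  hence "c = L" using c by simp
  have "F analytic_on {z}"
    unfolding F_def using z \<open>num analytic_on UNIV\<close> \<open>den analytic_on UNIV\<close>
    by (intro analytic_on_divide) (auto intro: analytic_on_subset)
  hence "H z = F z"
    unfolding H_def by simp
  thus ?thesis
    using c \<open>c = L\<close> z by (simp add: F_def field_simps)
qed

lemma dedekind_eta_inversion:
  assumes "\<tau> \<in> upper_half_plane"
  shows "norm (dedekind_eta (- 1 / \<tau>)) ^ 2 = norm \<tau> * norm (dedekind_eta \<tau>) ^ 2"
proof -
  define \<tau>' where "\<tau>' = - 1 / \<tau>"
  have \<tau>0: "\<tau> \<noteq> 0" and Im: "Im \<tau> > 0"
    using assms by (auto simp: upper_half_plane_def)
  have tt: "\<tau>' * \<tau> = - 1"
    using \<tau>0 by (simp add: \<tau>'_def)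
  have "Im \<tau>' > 0"
    using Im \<tau>0 unfolding \<tau>'_def by (simp add: Im_divide sum_power2_gt_zero_iff complex_eq_iff)
  hence \<tau>': "\<tau>' \<in> upper_half_plane"
    by (simp add: upper_half_plane_def)
  \<comment> \<open>The Gaussian factor gives the rescaled theta product for \<open>\<tau>'\<close>
    exactly the multipliers of \<open>jtheta \<tau>\<close> under \<open>z + 1\<close> and
    \<open>z + \<tau>\<close>, so their quotient is elliptic.\<close>
  define num where "num = (\<lambda>z. jtheta \<tau>' (z / \<tau>) * exp (- (of_real pi * \<i> * z\<^sup>2 / \<tau>)))"
  have num_1: "num (z + 1) = - num z" for z
  proof -
    define u where "u = (z + 1) / \<tau>"
    have "jtheta \<tau>' (u + \<tau>') = - exp (- (of_real pi * \<i> * (\<tau>' + 2 * u))) * jtheta \<tau>' u"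
      by (rule jtheta_plus_tau[OF \<tau>'])
    moreover have "u + \<tau>' = z / \<tau>"
      by (simp add: u_def \<tau>'_def add_divide_distrib)
    ultimately have "jtheta \<tau>' (z / \<tau>) * exp (- (of_real pi * \<i> * z\<^sup>2 / \<tau>)) =
       - jtheta \<tau>' u * (exp (- (of_real pi * \<i> * (\<tau>' + 2 * u))) * exp (- (of_real pi * \<i> * z\<^sup>2 / \<tau>)))"
      by simp
    also have "exp (- (of_real pi * \<i> * (\<tau>' + 2 * u))) * exp (- (of_real pi * \<i> * z\<^sup>2 / \<tau>)) =
        exp (- (of_real pi * \<i> * (z + 1)\<^sup>2 / \<tau>))"
      unfolding exp_add[symmetric] u_def \<tau>'_def using \<tau>0
      by (intro arg_cong[of _ _ exp]) (simp add: field_simps power2_eq_square)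
    finally show ?thesis
      by (simp add: num_def u_def)
  qed
  have num_\<tau>: "num (z + \<tau>) = - exp (- (of_real pi * \<i> * (\<tau> + 2 * z))) * num z" for z
  proof -
    have "(z + \<tau>) / \<tau> = z / \<tau> + 1"
      using \<tau>0 by (simp add: field_simps)
    moreover have "exp (- (of_real pi * \<i> * (z + \<tau>)\<^sup>2 / \<tau>)) =
        exp (- (of_real pi * \<i> * (\<tau> + 2 * z))) * exp (- (of_real pi * \<i> * z\<^sup>2 / \<tau>))"
      unfolding exp_add[symmetric] using \<tau>0
      by (intro arg_cong[of _ _ exp]) (simp add: field_simps power2_eq_square)
    ultimately show ?thesis
      by (simp add: num_def jtheta_plus_1)
  qed
  \<comment> \<open>The quotient of the slopes at 0: both functions have a simple zero there, and
    the scaling \<open>z / \<tau>\<close> contributes the factor \<open>1 / \<tau>\<close>.\<close>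
  define L where "L = jtheta_core \<tau>' 0 / (\<tau> * jtheta_core \<tau> 0)"
  have lim: "((\<lambda>z. num z / jtheta \<tau> z) \<longlongrightarrow> L) (at 0)"
  proof -
    have *: "((\<lambda>z. (exp (- (of_real pi * \<i> * (c * z))) - exp (of_real pi * \<i> * (c * z))) / z) \<longlongrightarrow>
        - (2 * of_real pi * \<i> * c)) (at 0)" for c
    proof -
      have "((\<lambda>z. exp (- (of_real pi * \<i> * (c * z))) - exp (of_real pi * \<i> * (c * z)))
          has_field_derivative - (2 * of_real pi * \<i> * c)) (at 0)"
        by (auto intro!: derivative_eq_intros)
      thus ?thesis by (simp add: has_field_derivative_iff)
    qed
    have cont: "((\<lambda>z. jtheta_core \<sigma> (c * z)) \<longlongrightarrow> jtheta_core \<sigma> 0) (at 0)"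
      if "\<sigma> \<in> upper_half_plane" for \<sigma> c
    proof -
      have "(\<lambda>z. jtheta_core \<sigma> (c * z)) holomorphic_on UNIV"
        by (rule holomorphic_on_compose_gen[OF _ holomorphic_jtheta_core[OF that], unfolded o_def])
           (auto intro!: holomorphic_intros)
      hence "isCont (\<lambda>z. jtheta_core \<sigma> (c * z)) 0"
        using holomorphic_on_imp_continuous_on continuous_on_eq_continuous_at by blast
      thus ?thesis by (simp add: isCont_def)
    qed
    define E where "E = (\<lambda>c z. (exp (- (of_real pi * \<i> * (c * z))) - exp (of_real pi * \<i> * (c * z))) / z)"
    have "((\<lambda>z. E (1 / \<tau>) z * jtheta_core \<tau>' (1 / \<tau> * z) * exp (- (of_real pi * \<i> * z\<^sup>2 / \<tau>)) /
             (E 1 z * jtheta_core \<tau> (1 * z))) \<longlongrightarrow>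
           - (2 * of_real pi * \<i> * (1 / \<tau>)) * jtheta_core \<tau>' 0 * exp (- (of_real pi * \<i> * 0\<^sup>2 / \<tau>)) /
             (- (2 * of_real pi * \<i> * 1) * jtheta_core \<tau> 0)) (at 0)"
      unfolding E_def
      by (rule tendsto_intros * cont \<tau>' assms refl | simp add: jtheta_core_0(2)[OF assms] \<tau>0)+
    also have "- (2 * of_real pi * \<i> * (1 / \<tau>)) * jtheta_core \<tau>' 0 * exp (- (of_real pi * \<i> * 0\<^sup>2 / \<tau>)) /
             (- (2 * of_real pi * \<i> * 1) * jtheta_core \<tau> 0) = L"
      by (simp add: L_def)
    finally show ?thesis
    proof (rule Lim_transform_eventually)
      show "\<forall>\<^sub>F z in at 0. E (1 / \<tau>) z * jtheta_core \<tau>' (1 / \<tau> * z) * exp (- (of_real pi * \<i> * z\<^sup>2 / \<tau>)) /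
             (E 1 z * jtheta_core \<tau> (1 * z)) = num z / jtheta \<tau> z"
        unfolding eventually_at_filter
        by (rule always_eventually)
           (simp add: num_def E_def jtheta_eq_core[OF assms] jtheta_eq_core[OF \<tau>'])
    qed
  qed
  have quot: "num z = L * jtheta \<tau> z" if "jtheta \<tau> z \<noteq> 0" for z
  proof (rule elliptic_quotient_constant[OF Im _ holomorphic_jtheta[OF assms] jtheta_zeroD[OF assms] _ _ lim that])
    show "num holomorphic_on UNIV"
      unfolding num_def
      by (intro holomorphic_intros holomorphic_on_compose_gen[OF _ holomorphic_jtheta[OF \<tau>'], unfolded o_def])
         (use \<tau>0 in auto)
    show "num (z + 1) / jtheta \<tau> (z + 1) = num z / jtheta \<tau> z" for z
      by (simp add: num_1 jtheta_plus_1)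
    show "num (z + \<tau>) / jtheta \<tau> (z + \<tau>) = num z / jtheta \<tau> z" for z
      by (simp add: num_\<tau> jtheta_plus_tau[OF assms])
  qed
  note half = jtheta_half_periods[OF assms] and half' = jtheta_half_periods[OF \<tau>']
  have nz: "jtheta \<tau> (1 / 2) \<noteq> 0" "jtheta \<tau> (\<tau> / 2) \<noteq> 0" "jtheta \<tau> ((1 + \<tau>) / 2) \<noteq> 0"
    using half by auto
  have cancel_L: "a * b = - c" if "a * (- 2 * b) = 2 * c" for a b c :: complex
  proof -
    have "c = - (a * b)"
      using that by simp
    thus ?thesis by simp
  qed
  \<comment> \<open>Division by \<open>\<tau>\<close> permutes the half periods up to sign and
    periods: \<open>1/2\<close>, \<open>\<tau>/2\<close>, \<open>(1+\<tau>)/2\<close> go to those of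
    \<open>\<tau>'/2\<close>, \<open>1/2\<close>, \<open>(1+\<tau>')/2\<close>. Both triple products
    are explicit exponentials, so \<open>L ^ 3\<close> is known. A cube root of unity stays
    undetermined, but the modulus does not see it.\<close>
  have "L ^ 3 * (- 2 * exp (- (of_real pi * \<i> * \<tau>))) = num (1 / 2) * num (\<tau> / 2) * num ((1 + \<tau>) / 2)"
    unfolding half[symmetric] quot[OF nz(1)] quot[OF nz(2)] quot[OF nz(3)]
    by (simp add: power3_eq_cube mult_ac)
  also have "num (1 / 2) = - jtheta \<tau>' (\<tau>' / 2) * exp (- (of_real pi * \<i> / (4 * \<tau>)))"
  proof -
    have "1 / 2 / \<tau> = - (\<tau>' / 2)"
      by (simp add: \<tau>'_def)
    thus ?thesis
      by (simp only: num_def jtheta_minus[OF \<tau>']) (simp add: power2_eq_square)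
  qed
  also have "num (\<tau> / 2) = jtheta \<tau>' (1 / 2) * exp (- (of_real pi * \<i> * \<tau> / 4))"
    using \<tau>0 by (simp add: num_def power2_eq_square mult_ac)
  also have "num ((1 + \<tau>) / 2) = jtheta \<tau>' ((1 + \<tau>') / 2) * exp (- (of_real pi * \<i> * (1 + \<tau>)\<^sup>2 / (4 * \<tau>)))"
  proof -
    have "(1 + \<tau>) / 2 / \<tau> = - ((1 + \<tau>') / 2) + 1"
      using \<tau>0 by (simp add: \<tau>'_def field_simps)
    thus ?thesis
      by (simp only: num_def jtheta_plus_1 jtheta_minus[OF \<tau>']) (simp add: power_divide mult_ac)
  qed
  also have "- jtheta \<tau>' (\<tau>' / 2) * exp (- (of_real pi * \<i> / (4 * \<tau>))) *
        (jtheta \<tau>' (1 / 2) * exp (- (of_real pi * \<i> * \<tau> / 4))) *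
        (jtheta \<tau>' ((1 + \<tau>') / 2) * exp (- (of_real pi * \<i> * (1 + \<tau>)\<^sup>2 / (4 * \<tau>)))) =
      - (jtheta \<tau>' (1 / 2) * jtheta \<tau>' (\<tau>' / 2) * jtheta \<tau>' ((1 + \<tau>') / 2)) *
        (exp (- (of_real pi * \<i> / (4 * \<tau>))) * exp (- (of_real pi * \<i> * \<tau> / 4)) *
         exp (- (of_real pi * \<i> * (1 + \<tau>)\<^sup>2 / (4 * \<tau>))))"
    by (simp add: mult_ac)
  also have "\<dots> = 2 * (exp (- (of_real pi * \<i> * \<tau>')) * (exp (- (of_real pi * \<i> / (4 * \<tau>))) *
      exp (- (of_real pi * \<i> * \<tau> / 4)) * exp (- (of_real pi * \<i> * (1 + \<tau>)\<^sup>2 / (4 * \<tau>)))))"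
    unfolding half' by simp
  also have "exp (- (of_real pi * \<i> * \<tau>')) * (exp (- (of_real pi * \<i> / (4 * \<tau>))) *
      exp (- (of_real pi * \<i> * \<tau> / 4)) * exp (- (of_real pi * \<i> * (1 + \<tau>)\<^sup>2 / (4 * \<tau>)))) =
      exp (of_real pi * \<i> / (2 * \<tau>) - of_real pi * \<i> * \<tau> / 2 - of_real pi * \<i> / 2)"
    unfolding exp_add[symmetric] \<tau>'_def using \<tau>0
    by (intro arg_cong[of _ _ exp]) (simp add: field_simps power2_eq_square)
  finally have "L ^ 3 * exp (- (of_real pi * \<i> * \<tau>)) =
      - exp (of_real pi * \<i> / (2 * \<tau>) - of_real pi * \<i> * \<tau> / 2 - of_real pi * \<i> / 2)"
    by (rule cancel_L)
  hence "L ^ 3 * (exp (- (of_real pi * \<i> * \<tau>)) * exp (of_real pi * \<i> * \<tau>)) =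
      - (exp (of_real pi * \<i> / (2 * \<tau>) - of_real pi * \<i> * \<tau> / 2 - of_real pi * \<i> / 2) *
      exp (of_real pi * \<i> * \<tau>))"
    by (metis mult.assoc mult_minus_left)
  hence "L ^ 3 = - (exp (of_real pi * \<i> / (2 * \<tau>) - of_real pi * \<i> * \<tau> / 2 - of_real pi * \<i> / 2) *
      exp (of_real pi * \<i> * \<tau>))"
    by (simp flip: exp_add)
  also have "\<dots> = - exp (of_real pi * \<i> / (2 * \<tau>) + of_real pi * \<i> * \<tau> / 2 - of_real pi * \<i> / 2)"
    unfolding exp_add[symmetric] by (intro arg_cong[of _ _ "\<lambda>x. - exp x"]) (simp add: field_simps)
  finally have L_cubed: "L ^ 3 = - exp (of_real pi * \<i> / (2 * \<tau>) + of_real pi * \<i> * \<tau> / 2 - of_real pi * \<i> / 2)" .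
  have L3: "norm L ^ 3 = norm (exp (of_real pi * \<i> / (6 * \<tau>) + of_real pi * \<i> * \<tau> / 6)) ^ 3"
  proof -
    have "of_real pi * \<i> / (2 * \<tau>) = 3 * (of_real pi * \<i> / (6 * \<tau>))"
      using \<tau>0 by (simp add: field_simps)
    hence "Re (of_real pi * \<i> / (2 * \<tau>)) = 3 * Re (of_real pi * \<i> / (6 * \<tau>))"
      by (simp only: times_complex.sel) simp
    hence "norm L ^ 3 = exp (3 * Re (of_real pi * \<i> / (6 * \<tau>) + of_real pi * \<i> * \<tau> / 6))"
      using L_cubed by (simp flip: norm_power)
    thus ?thesis by (simp flip: exp_of_nat_mult)
  qed
  hence L: "norm L = norm (exp (of_real pi * \<i> / (6 * \<tau>) + of_real pi * \<i> * \<tau> / 6))"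
    by (rule power_eq_imp_eq_base) auto
  have eta: "dedekind_eta \<sigma> ^ 2 = exp (of_real pi * \<i> * \<sigma> / 6) * jtheta_core \<sigma> 0"
    if "\<sigma> \<in> upper_half_plane" for \<sigma>
    unfolding dedekind_eta_qpoch jtheta_core_0(1)[OF that] power_mult_distrib
    by (simp add: mult_ac flip: exp_of_nat_mult)
  have "jtheta_core \<tau>' 0 = L * \<tau> * jtheta_core \<tau> 0"
    using \<tau>0 jtheta_core_0(2)[OF assms] by (simp add: L_def)
  hence "norm (dedekind_eta \<tau>' ^ 2) =
      norm (exp (of_real pi * \<i> * \<tau>' / 6)) * norm (exp (of_real pi * \<i> / (6 * \<tau>) + of_real pi * \<i> * \<tau> / 6)) *
      norm \<tau> * norm (jtheta_core \<tau> 0)"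
    unfolding eta[OF \<tau>'] by (simp add: norm_mult L mult_ac)
  also have "norm (exp (of_real pi * \<i> * \<tau>' / 6)) * norm (exp (of_real pi * \<i> / (6 * \<tau>) + of_real pi * \<i> * \<tau> / 6)) =
      norm (exp (of_real pi * \<i> * \<tau> / 6))"
    unfolding norm_mult[symmetric] exp_add[symmetric] \<tau>'_def using \<tau>0
    by (intro arg_cong[of _ _ "\<lambda>x. norm (exp x)"]) (simp add: field_simps)
  finally show ?thesis
    using eta[OF assms] by (simp add: norm_mult mult_ac \<tau>'_def flip: norm_power)
qed

section \<open>Arithmetic of the cusps\<close>

text \<open>The system is triangular with diagonal 1 with respect to divisibility, so recursion over
  the proper divisors solves it. This yields Moebius inversion as mere existence, with no formula
  for \<open>c\<close>.\<close>

lemma divisor_sum_inversion: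
  fixes b :: "nat \<Rightarrow> real"
  obtains c where "\<And>n. n > 0 \<Longrightarrow> (\<Sum>e | e dvd n. c e) = b n"
proof -
  define c where "c = wfrec less_than (\<lambda>g n. b n - (\<Sum>e | e dvd n \<and> e < n. g e))"
  have c: "c n = b n - (\<Sum>e | e dvd n \<and> e < n. c e)" for n
    unfolding c_def by (subst wfrec[OF wf_less_than]) (simp add: cut_def)
  have "(\<Sum>e | e dvd n. c e) = b n" if "n > 0" for n
  proof -
    have "{e. e dvd n} = insert n {e. e dvd n \<and> e < n}"
      using that by (auto intro!: le_neq_implies_less dvd_imp_le)
    hence "(\<Sum>e | e dvd n. c e) = c n + (\<Sum>e | e dvd n \<and> e < n. c e)"
      by simp
    thus ?thesis using c[of n] by simp
  qed
  thus ?thesis by (rule that)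
qed

text \<open>Telescoping: \<open>1/k\<^sup>2 \<le> 1/(k-1) - 1/k\<close>.\<close>

lemma sum_inverse_squares_less_1: "(\<Sum>k=2..n. 1 / (real k)\<^sup>2) < 1"
proof -
  have "(\<Sum>k=2..n. 1 / (real k)\<^sup>2) \<le> 1 - 1 / real n" if "n \<ge> 1"
    using that
  proof (induction n rule: dec_induct)
    case (step n)
    have "1 / (real (Suc n))\<^sup>2 \<le> 1 / real n - 1 / real (Suc n)"
      using step(1) by (simp add: divide_simps power2_eq_square) 
    with step show ?case by simp
  qed auto
  thus ?thesis
    by (cases "n \<ge> 1") (auto intro: le_less_trans)
qed

text \<open>\<open>J\<close> is Jordan's totient \<open>J_2\<close>. By induction its values at
  smaller divisors are positive, hence \<open>J e \<le> e\<^sup>2\<close> for proper divisors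
  \<open>e\<close>. Writing \<open>e = n / k\<close> with \<open>k \<ge> 2\<close>, these contribute
  less than \<open>n\<^sup>2\<close> in total, so something positive is left for
  \<open>J n\<close>.\<close>

lemma jordan_totient_pos:
  fixes J :: "nat \<Rightarrow> real"
  assumes J: "\<And>n. n > 0 \<Longrightarrow> (\<Sum>e | e dvd n. J e) = (real n)\<^sup>2"
    and "n > 0"
  shows "J n > 0"
  using \<open>n > 0\<close>
proof (induction n rule: less_induct)
  case (less n)
  have fin: "finite {e. e dvd n}"
    using less.prems by simp
  have J_le: "J e \<le> (real e)\<^sup>2" if "e dvd n" "e < n" for e
  proof -
    have "e > 0" using that(1) less.prems by (rule dvd_pos_nat[rotated])
    have "J e \<le> (\<Sum>d | d dvd e. J d)"
    proof (rule member_le_sum)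
      fix d assume "d \<in> {d. d dvd e} - {e}"
      hence "d > 0" "d < n" using \<open>e > 0\<close> that(2)
        by (auto dest: dvd_imp_le intro: dvd_pos_nat intro!: Nat.gr0I)
      thus "0 \<le> J d" using less.IH less_imp_le by blast
    qed (use \<open>e > 0\<close> in auto)
    thus ?thesis using J[OF \<open>e > 0\<close>] by simp
  qed
  have split: "{e. e dvd n} = insert n {e. e dvd n \<and> e < n}"
    using less.prems by (auto intro!: le_neq_implies_less dvd_imp_le)
  have "(\<Sum>e | e dvd n \<and> e < n. J e) \<le> (\<Sum>e | e dvd n \<and> e < n. (real e)\<^sup>2)"
    by (intro sum_mono J_le) auto
  also have "\<dots> = (\<Sum>k\<in>(\<lambda>e. n div e) ` {e. e dvd n \<and> e < n}. (real n)\<^sup>2 * (1 / (real k)\<^sup>2))"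
  proof (subst sum.reindex)
    show "inj_on (\<lambda>e. n div e) {e. e dvd n \<and> e < n}"
      by (rule inj_on_inverseI[where g = "\<lambda>k. n div k"]) (use less.prems in \<open>auto elim!: dvdE\<close>)
    show "(\<Sum>e | e dvd n \<and> e < n. (real e)\<^sup>2) =
        sum ((\<lambda>k. (real n)\<^sup>2 * (1 / (real k)\<^sup>2)) \<circ> (\<lambda>e. n div e)) {e. e dvd n \<and> e < n}"
      using less.prems by (intro sum.cong refl) (auto simp: real_of_nat_div power_divide)
  qed
  also have "\<dots> \<le> (\<Sum>k=2..n. (real n)\<^sup>2 * (1 / (real k)\<^sup>2))"
  proof (rule sum_mono2)
    show "(\<lambda>e. n div e) ` {e. e dvd n \<and> e < n} \<subseteq> {2..n}"
      by (auto elim!: dvdE)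
  qed auto
  also have "\<dots> < (real n)\<^sup>2"
    using mult_strict_left_mono[OF sum_inverse_squares_less_1[of n], of "(real n)\<^sup>2"] less.prems
    by (simp add: sum_distrib_left)
  finally show ?case
    using J[OF less.prems] fin unfolding split by (simp add: finite_subset)
qed

text \<open>Smith's factorization of a GCD matrix: \<open>gcd(t, d)\<^sup>2 = \<Sum> J e\<close> over the common divisors \<open>e\<close>
  of \<open>t\<close> and \<open>d\<close>, so the system splits into two triangular ones.\<close>

lemma gcd_square_system_solvable:
  fixes b :: "nat \<Rightarrow> real"
  assumes "N > 0"
  obtains x where "\<And>d. d dvd N \<Longrightarrow> (\<Sum>t | t dvd N. x t * (real (gcd t d))\<^sup>2) = b d"
proof -
  obtain J :: "nat \<Rightarrow> real" where J: "\<And>n. n > 0 \<Longrightarrow> (\<Sum>e | e dvd n. J e) = (real n)\<^sup>2"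
    using divisor_sum_inversion[of "\<lambda>n. (real n)\<^sup>2"] by blast
  obtain c where c: "\<And>n. n > 0 \<Longrightarrow> (\<Sum>e | e dvd n. c e) = b n"
    using divisor_sum_inversion[of b] by blast
  \<comment> \<open>The sum of the unknowns over the multiples of \<open>e\<close> dividing
    \<open>N\<close> should be \<open>c e / J e\<close>. The map \<open>t \<mapsto> N div t\<close>
    turns these multiples into the divisors of \<open>N div e\<close>, which explains the argument
    \<open>N div n\<close> here and the solution \<open>y (N div t)\<close> below.\<close>
  obtain y where y: "\<And>n. n > 0 \<Longrightarrow> (\<Sum>s | s dvd n. y s) = c (N div n) / J (N div n)"
    using divisor_sum_inversion[of "\<lambda>n. c (N div n) / J (N div n)"] by blast
  show ?thesis
  proof (rule that[of "\<lambda>t. y (N div t)"])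
    fix d assume d: "d dvd N"
    have "d > 0" using d assms by (rule dvd_pos_nat[rotated])
    have fin: "finite {t. t dvd N}"
      using assms by simp
    have "(\<Sum>t | t dvd N. y (N div t) * (real (gcd t d))\<^sup>2) =
        (\<Sum>t | t dvd N. \<Sum>e | e dvd d \<and> e dvd t. y (N div t) * J e)"
    proof (intro sum.cong refl)
      fix t assume "t \<in> {t. t dvd N}"
      have "(real (gcd t d))\<^sup>2 = (\<Sum>e | e dvd gcd t d. J e)"
        using J[of "gcd t d"] \<open>d > 0\<close> by simp
      also have "{e. e dvd gcd t d} = {e. e dvd d \<and> e dvd t}"
        by auto
      finally show "y (N div t) * (real (gcd t d))\<^sup>2 = (\<Sum>e | e dvd d \<and> e dvd t. y (N div t) * J e)"
        by (simp add: sum_distrib_left)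
    qed
    also have "\<dots> = (\<Sum>e | e dvd d. \<Sum>t | t dvd N \<and> e dvd t. y (N div t) * J e)"
      using sum.swap_restrict[of "{t. t dvd N}" "{e. e dvd d}" "\<lambda>t e. y (N div t) * J e" "\<lambda>t e. e dvd t"]
        fin \<open>d > 0\<close> by simp
    also have "\<dots> = (\<Sum>e | e dvd d. c e)"
    proof (intro sum.cong refl)
      fix e assume "e \<in> {e. e dvd d}"
      hence e: "e dvd N" "e > 0" using d \<open>d > 0\<close> by (auto intro: dvd_trans dvd_pos_nat)
      hence Ne: "N div e > 0" "N div (N div e) = e"
        using assms by (auto elim!: dvdE)
      have "(\<Sum>t | t dvd N \<and> e dvd t. y (N div t)) = (\<Sum>s | s dvd N div e. y s)"
      proof (rule sum.reindex_bij_witness[of _ "\<lambda>s. N div s" "\<lambda>t. N div t"])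
        fix t assume "t \<in> {t. t dvd N \<and> e dvd t}"
        thus "N div (N div t) = t" "N div t \<in> {s. s dvd N div e}"
          using assms by (auto elim!: dvdE)
      next
        fix s assume "s \<in> {s. s dvd N div e}"
        then obtain r where r: "N = e * s * r"
          using e(1) by (metis dvd_def dvd_div_mult_self mem_Collect_eq mult.assoc mult.commute)
        thus "N div (N div s) = s" "N div s \<in> {t. t dvd N \<and> e dvd t}"
          using assms by auto
      qed auto
      also have "\<dots> = c e / J e"
        using y[OF Ne(1)] Ne(2) by simp
      finally show "(\<Sum>t | t dvd N \<and> e dvd t. y (N div t) * J e) = c e"
        using jordan_totient_pos[OF J e(2)] by (simp flip: sum_distrib_right)
    qed
    also have "\<dots> = b d"
      by (rule c[OF \<open>d > 0\<close>])
    finally show "(\<Sum>t | t dvd N. y (N div t) * (real (gcd t d))\<^sup>2) = b d" .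
  qed
qed

section \<open>Equivalence of the cusps of \<open>Gamma0 N\<close>\<close>

text \<open>The square of the gcd divides \<open>N\<close>, hence \<open>8 * M\<close>. An odd
  number whose square divides \<open>8 * M\<close> is 1, as \<open>M\<close> is squarefree, and 4
  cannot divide the gcd, as 16 does not divide \<open>8 * M\<close>. The special shape of
  \<open>N\<close> acts through this bound.\<close>

lemma gcd_cofactor_dvd_2:
  fixes N M d :: nat
  assumes "odd M" "squarefree M" "N = 4 * M \<or> N = 8 * M" "d dvd N"
  shows "gcd d (N div d) dvd 2"
proof -
  define g where "g = gcd d (N div d)"
  have "g ^ 2 dvd d * (N div d)"
    unfolding g_def power2_eq_square by (intro mult_dvd_mono) auto
  hence "g ^ 2 dvd N"
    using assms(4) by simp
  hence g8: "g ^ 2 dvd 8 * M"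
    using assms(3) dvd_mult[of "g ^ 2" "4 * M" 2] by auto
  have odd_case: "h = 1" if "h ^ 2 dvd 8 * M" "odd h" for h
  proof -
    have "coprime (h ^ 2) (2 ^ 3)"
      using that(2) by (intro coprime_power_left_iff[THEN iffD2] coprime_power_right_iff[THEN iffD2]) auto
    hence "h ^ 2 dvd M"
      using that(1) by (simp add: coprime_dvd_mult_right_iff)
    thus "h = 1"
      using assms(2) by (auto simp: squarefree_def)
  qed
  show ?thesis
  proof (cases "even g")
    case True
    then obtain h where h: "g = 2 * h" by blast
    hence h2: "h ^ 2 dvd 2 * M"
      using g8 by (simp add: power_mult_distrib) 
    have "odd h"
    proof
      assume "even h"
      then obtain j where "h = 2 * j" by blast
      hence "2 * (2 * j ^ 2) dvd 2 * M"
        using h2 by (simp add: power_mult_distrib)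
      hence "2 * j ^ 2 dvd M" by simp
      thus False using assms(1) by (meson dvd_mult_left)
    qed
    moreover have "h ^ 2 dvd 8 * M"
      using dvd_mult[OF h2, of 4] by simp
    ultimately have "h = 1" using odd_case by blast
    thus ?thesis using h by (simp add: g_def)
  next
    case False
    thus ?thesis using odd_case[OF g8] by (simp add: g_def)
  qed
qed

lemma linear_congruence_solvable:
  fixes a b m :: int
  assumes "gcd a m dvd b"
  obtains n where "m dvd n * a - b"
proof -
  obtain u v where uv: "u * a + v * m = gcd a m"
    using bezout_int by blast
  obtain k where k: "b = gcd a m * k"
    using assms by blast
  have "b = k * (u * a + v * m)"
    by (simp add: k uv)
  hence "(k * u) * a - b = m * (- (k * v))"
    by (simp add: algebra_simps)
  thus ?thesis
    using that[of "k * u"] by simp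
qed

text \<open>The conclusion says that \<open>\<gamma>' T\<^sup>n \<gamma>\<inverse>\<close> lies in \<open>\<Gamma>\<^sub>0(N)\<close>.\<close>

lemma cusp_equivalence:
  fixes N M :: nat and a b c d a' b' c' d' :: int
  assumes N: "odd M" "squarefree M" "N = 4 * M \<or> N = 8 * M"
    and det: "a * d - b * c = 1" "a' * d' - b' * c' = 1"
    and gcd: "gcd c (int N) = gcd c' (int N)"
  obtains n where "int N dvd c' * d - (d' + n * c') * c"
proof -
  define e where "e = gcd c (int N)"
  have "N > 0" using N by (auto intro: Nat.gr0I)
  hence "e > 0" unfolding e_def by (simp add: gcd_pos_int)
  obtain c1 where c1: "c = e * c1" by (metis e_def gcd_dvd1 dvdE)
  obtain c2 where c2: "c' = e * c2" by (metis e_def gcd gcd_dvd1 dvdE)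
  obtain K where K: "int N = e * K" by (metis e_def gcd_dvd2 dvdE)
  have "K > 0" using K \<open>N > 0\<close> \<open>e > 0\<close> by (metis of_nat_0_less_iff zero_less_mult_pos)
  have "e * gcd c1 K = gcd c (int N)" "e * gcd c2 K = gcd c' (int N)"
    using gcd_mult_distrib_int[of e c1 K] gcd_mult_distrib_int[of e c2 K] \<open>e > 0\<close>
    by (simp_all only: c1 c2 K abs_of_pos)
  hence "e * gcd c1 K = e * 1" "e * gcd c2 K = e * 1"
    by (simp_all add: e_def gcd)
  hence cop: "coprime c1 K" "coprime c2 K"
    using \<open>e > 0\<close> unfolding coprime_iff_gcd_eq_1 by (simp_all only: mult_cancel_left) auto
  define g where "g = gcd e K"
  obtain e' where e': "e = int e'"
    using \<open>e > 0\<close> by (metis less_imp_le zero_le_imp_eq_int)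
  obtain K' where K': "K = int K'"
    using \<open>K > 0\<close> by (metis less_imp_le zero_le_imp_eq_int)
  have N': "N = e' * K'"
    using K unfolding e' K' by (simp only: of_nat_eq_iff flip: of_nat_mult)
  have "gcd e' (N div e') dvd 2"
    by (rule gcd_cofactor_dvd_2[OF N]) (simp add: N')
  hence "int (gcd e' K') dvd int 2"
    using \<open>e > 0\<close> unfolding int_dvd_int_iff by (simp add: N' e')
  hence "g dvd 2"
    by (simp add: g_def e' K')
  \<comment> \<open>As \<open>g\<close> divides 2, only parity matters. If \<open>g = 2\<close>,
    then \<open>e\<close> and \<open>K\<close> are even: coprimality to \<open>K\<close> makes
    \<open>c1\<close> and \<open>c2\<close> odd, and the determinants make \<open>d\<close> and
    \<open>d'\<close> odd, so the difference is even.\<close>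
  have g: "g dvd c2 * d - d' * c1"
  proof (cases "even g")
    case True
    hence ek: "even e" "even K" by (auto simp: g_def)
    hence "odd c1" "odd c2" using cop by (metis coprime_common_divisor odd_one)+
    moreover have "odd (a * d - b * c)" "odd (a' * d' - b' * c')"
      by (simp_all add: det)
    hence "odd d" "odd d'"
      using ek(1) by (auto simp: c1 c2)
    ultimately have "even (c2 * d - d' * c1)" by simp
    thus ?thesis using \<open>g dvd 2\<close> by (rule dvd_trans[rotated])
  next
    case False
    have "g > 0" using \<open>e > 0\<close> by (simp add: g_def gcd_pos_int)
    hence "g = 1"
      using \<open>g dvd 2\<close> False zdvd_imp_le[of g 2] by (cases "g = 2") auto
    thus ?thesis by simp
  qed
  \<comment> \<open>After division by \<open>e\<close> the goal is a linear congruence for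
    \<open>n\<close> modulo \<open>K\<close> with coefficient \<open>c1 * c2 * e\<close>; this gcd
    decides its solvability.\<close>
  have "gcd (c1 * c2 * e) K = g"
    using cop by (simp add: g_def gcd_mult_left_left_cancel coprime_commute)
  with g obtain n where "K dvd n * (c1 * c2 * e) - (c2 * d - d' * c1)"
    using linear_congruence_solvable[of "c1 * c2 * e" K "c2 * d - d' * c1"] by auto
  hence "e * K dvd e * (n * (c1 * c2 * e) - (c2 * d - d' * c1))"
    by (rule mult_dvd_mono[OF dvd_refl])
  hence "int N dvd - (c' * d - (d' + n * c') * c)"
    by (simp add: K c1 c2 algebra_simps)
  thus ?thesis
    using that by (simp only: dvd_minus_iff)
qed

section \<open>Growth at the cusps\<close>

lemma upper_half_planeI: "Im \<tau> > 0 \<Longrightarrow> \<tau> \<in> upper_half_plane"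
  by (simp add: upper_half_plane_def)

lemma upper_half_planeD: "\<tau> \<in> upper_half_plane \<Longrightarrow> Im \<tau> > 0"
  by (simp add: upper_half_plane_def)

section \<open>The action of \<open>SL2Z\<close> on the upper half-plane\<close>

fun mat2_mult :: "int_mat2 \<Rightarrow> int_mat2 \<Rightarrow> int_mat2" where
  "mat2_mult (a, b, c, d) (a', b', c', d') =
     (a * a' + b * c', a * b' + b * d', c * a' + d * c', c * b' + d * d')"

lemma mat2_mult_in_SL2Z:
  assumes "\<gamma> \<in> SL2Z" "\<delta> \<in> SL2Z"
  shows "mat2_mult \<gamma> \<delta> \<in> SL2Z"
proof -
  obtain a b c d where \<gamma>: "\<gamma> = (a, b, c, d)" by (cases \<gamma>) auto
  obtain a' b' c' d' where \<delta>: "\<delta> = (a', b', c', d')" by (cases \<delta>) auto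
  have "(a * a' + b * c') * (c * b' + d * d') - (a * b' + b * d') * (c * a' + d * c') =
      (a * d - b * c) * (a' * d' - b' * c')"
    by (simp add: algebra_simps)
  thus ?thesis
    using assms by (simp add: \<gamma> \<delta> SL2Z_def)
qed

lemma automorphy_nonzero:
  assumes "\<gamma> \<in> SL2Z" "\<tau> \<in> upper_half_plane"
  shows "automorphy \<gamma> \<tau> \<noteq> 0"
proof -
  obtain a b c d where \<gamma>: "\<gamma> = (a, b, c, d)" by (cases \<gamma>) auto
  show ?thesis
  proof
    assume "automorphy \<gamma> \<tau> = 0"
    hence "of_int c * Im \<tau> = 0" "of_int c * Re \<tau> + of_int d = 0"
      by (auto simp: \<gamma> complex_eq_iff)
    hence "c = 0" "d = 0"
      using upper_half_planeD[OF assms(2)] by auto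
    thus False using assms(1) by (simp add: \<gamma> SL2Z_def)
  qed
qed

lemma Im_moebius:
  assumes "\<gamma> \<in> SL2Z" "\<tau> \<in> upper_half_plane"
  shows "Im (moebius \<gamma> \<tau>) = Im \<tau> / norm (automorphy \<gamma> \<tau>) ^ 2"
proof -
  obtain a b c d where \<gamma>: "\<gamma> = (a, b, c, d)" by (cases \<gamma>) auto
  have "real_of_int (a * d - b * c) = 1"
    using assms(1) by (simp add: \<gamma> SL2Z_def)
  hence det: "real_of_int a * real_of_int d - real_of_int b * real_of_int c = 1"
    by simp
  have im: "Im ((of_int a * \<tau> + of_int b) * cnj (of_int c * \<tau> + of_int d)) =
      (real_of_int a * real_of_int d - real_of_int b * real_of_int c) * Im \<tau>"
    by (simp add: algebra_simps)
  show ?thesis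
    unfolding \<gamma> moebius.simps automorphy.simps
    by (subst complex_div_cnj) (simp only: im det mult_1_left Im_divide_of_real flip: of_real_power)
qed

lemma moebius_in_upper_half_plane:
  assumes "\<gamma> \<in> SL2Z" "\<tau> \<in> upper_half_plane"
  shows "moebius \<gamma> \<tau> \<in> upper_half_plane"
  using automorphy_nonzero[OF assms] upper_half_planeD[OF assms(2)]
  by (intro upper_half_planeI) (simp add: Im_moebius[OF assms])

lemma moebius_mat2_mult:
  assumes "\<gamma> \<in> SL2Z" "\<delta> \<in> SL2Z" "\<tau> \<in> upper_half_plane"
  shows "moebius (mat2_mult \<gamma> \<delta>) \<tau> = moebius \<gamma> (moebius \<delta> \<tau>)"
proof -
  obtain a b c d where \<gamma>: "\<gamma> = (a, b, c, d)" by (cases \<gamma>) auto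
  obtain a' b' c' d' where \<delta>: "\<delta> = (a', b', c', d')" by (cases \<delta>) auto
  define u where "u = of_int a' * \<tau> + of_int b'"
  define v where "v = of_int c' * \<tau> + of_int d'"
  have v: "v \<noteq> 0"
    using automorphy_nonzero[OF assms(2,3)] by (simp add: v_def \<delta>)
  have "moebius \<gamma> (moebius \<delta> \<tau>) = ((of_int a * u + of_int b * v) / v) / ((of_int c * u + of_int d * v) / v)"
    using v by (simp add: \<gamma> \<delta> u_def[symmetric] v_def[symmetric] add_divide_distrib)
  also have "\<dots> = (of_int a * u + of_int b * v) / (of_int c * u + of_int d * v)"
    using v by simp
  also have "\<dots> = moebius (mat2_mult \<gamma> \<delta>) \<tau>"
    by (simp add: \<gamma> \<delta> u_def v_def algebra_simps)
  finally show ?thesis by simp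
qed

text \<open>With \<open>\<bar>Re \<sigma>\<bar> \<le> 1/2\<close> after a translation and
  \<open>Im \<sigma> < 1/2\<close>, the squared modulus of \<open>\<sigma>\<close> is at most
  \<open>1/4 + 1/4\<close>, so inversion at least doubles the imaginary part. The height
  \<open>1/2\<close>, below that of the usual fundamental domain, is what makes finitely many
  doublings suffice without a minimality argument.\<close>

lemma moebius_reduction:
  assumes "\<tau> \<in> upper_half_plane"
  obtains \<gamma> \<sigma> where "\<gamma> \<in> SL2Z" "Im \<sigma> \<ge> 1 / 2" "\<tau> = moebius \<gamma> \<sigma>"
proof -
  have "\<exists>\<gamma> \<sigma>. \<gamma> \<in> SL2Z \<and> Im \<sigma> \<ge> 1 / 2 \<and> \<tau> = moebius \<gamma> \<sigma>" if "Im \<tau> \<ge> 1 / 2 ^ Suc n" for n \<tau>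
    using that
  proof (induction n arbitrary: \<tau>)
    case 0
    show ?case
      by (rule exI[of _ "(1, 0, 0, 1)"], rule exI[of _ \<tau>]) (use 0 in \<open>simp add: SL2Z_def\<close>)
  next
    case (Suc n)
    show ?case
    proof (cases "Im \<tau> \<ge> 1 / 2")
      case True
      thus ?thesis
        by (intro exI[of _ "(1, 0, 0, 1)"] exI[of _ \<tau>]) (simp add: SL2Z_def)
    next
      case False
      have pos: "Im \<tau> > 0"
        by (rule less_le_trans[OF _ Suc.prems]) simp
      define m where "m = round (Re \<tau>)"
      define \<sigma> where "\<sigma> = \<tau> - of_int m"
      define \<rho> where "\<rho> = - 1 / \<sigma>"
      have "\<bar>Re \<sigma>\<bar> \<le> 1 / 2"
        using of_int_round_abs_le[of "Re \<tau>"] by (simp add: \<sigma>_def m_def abs_minus_commute)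
      hence "(Re \<sigma>)\<^sup>2 \<le> (1/2)\<^sup>2"
        by (metis abs_le_square_iff abs_of_nonneg divide_nonneg_nonneg zero_le_numeral zero_le_one)
      moreover have "(Im \<sigma>)\<^sup>2 \<le> (1/2)\<^sup>2"
        using False pos by (intro power_mono) (auto simp: \<sigma>_def)
      ultimately have le: "(Re \<sigma>)\<^sup>2 + (Im \<sigma>)\<^sup>2 \<le> 1 / 2"
        by (simp add: power2_eq_square)
      have "(Im \<sigma>)\<^sup>2 > 0" using pos by (simp add: \<sigma>_def)
      hence ge: "(Re \<sigma>)\<^sup>2 + (Im \<sigma>)\<^sup>2 > 0" by (simp add: add_nonneg_pos)
      have "2 * Im \<tau> \<le> Im \<tau> / ((Re \<sigma>)\<^sup>2 + (Im \<sigma>)\<^sup>2)"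
        using mult_left_mono[OF le, of "2 * Im \<tau>"] ge pos by (simp add: pos_le_divide_eq)
      also have "\<dots> = Im \<rho>"
        by (simp add: \<rho>_def Im_divide \<sigma>_def)
      finally have "Im \<rho> \<ge> 1 / 2 ^ Suc n"
        using Suc.prems by simp
      from Suc.IH[OF this] obtain \<gamma> \<tau>' where \<gamma>: "\<gamma> \<in> SL2Z" "Im \<tau>' \<ge> 1 / 2" "\<rho> = moebius \<gamma> \<tau>'"
        by blast
      have S: "(m, - 1, 1, 0) \<in> SL2Z" by (simp add: SL2Z_def)
      have "\<sigma> \<noteq> 0" using ge by auto
      hence "\<rho> \<noteq> 0" "- 1 / \<rho> = \<sigma>"
        by (simp_all add: \<rho>_def)
      hence "moebius (m, - 1, 1, 0) \<rho> = of_int m + \<sigma>"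
        by (simp add: diff_divide_distrib)
      hence "\<tau> = moebius (m, - 1, 1, 0) \<rho>"
        by (simp add: \<sigma>_def)
      also have "\<dots> = moebius (mat2_mult (m, - 1, 1, 0) \<gamma>) \<tau>'"
        unfolding \<gamma>(3) using \<gamma>(2)
        by (intro moebius_mat2_mult[symmetric] S \<gamma>(1)) (simp add: upper_half_plane_def)
      finally show ?thesis
        using mat2_mult_in_SL2Z[OF S \<gamma>(1)] \<gamma>(2) by blast
    qed
  qed
  moreover obtain n where "1 / 2 ^ Suc n \<le> Im \<tau>"
  proof -
    obtain n where "(1 / 2) ^ n < Im \<tau>"
      using real_arch_pow_inv[OF upper_half_planeD[OF assms], of "1 / 2"] by auto
    hence "1 / 2 ^ Suc n \<le> Im \<tau>"
      using upper_half_planeD[OF assms] by (simp add: power_one_over field_simps) 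
    thus ?thesis by (rule that)
  qed
  ultimately show ?thesis
    using that by blast
qed

section \<open>The invariant height of eta and its growth at the cusps\<close>

text \<open>The logarithm of \<open>\<bar>\<eta>\<bar> y^(1/4)\<close>, which is invariant under the
  full modular group because eta has weight 1/2. In additive form, real exponents become
  coefficients.\<close>

definition eta_height :: "complex \<Rightarrow> real" where
  "eta_height \<tau> = Re (ln_eta \<tau>) + ln (Im \<tau>) / 4"

lemma Re_ln_eta: "\<tau> \<in> upper_half_plane \<Longrightarrow> Re (ln_eta \<tau>) = ln (norm (dedekind_eta \<tau>))"
  by (simp flip: exp_ln_eta)

lemma eta_height_translate: "eta_height (\<tau> + of_int n) = eta_height \<tau>"
  by (simp add: eta_height_def ln_eta_def nome_add)

lemma eta_height_inversion:
  assumes "\<tau> \<in> upper_half_plane"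
  shows "eta_height (- 1 / \<tau>) = eta_height \<tau>"
proof -
  have Im: "Im \<tau> > 0" and nz: "\<tau> \<noteq> 0"
    using assms by (auto simp: upper_half_plane_def)
  have Im': "Im (- 1 / \<tau>) = Im \<tau> / norm \<tau> ^ 2"
    by (simp add: Im_divide cmod_power2)
  hence "- 1 / \<tau> \<in> upper_half_plane"
    using Im nz by (simp add: upper_half_plane_def)
  note H = Re_ln_eta[OF this] Re_ln_eta[OF assms]
  have eta_nz: "dedekind_eta (- 1 / \<tau>) \<noteq> 0" "dedekind_eta \<tau> \<noteq> 0"
    using assms \<open>- 1 / \<tau> \<in> _\<close> by (simp_all flip: exp_ln_eta)
  have "ln (norm (dedekind_eta (- 1 / \<tau>)) ^ 2) = ln (norm \<tau> * norm (dedekind_eta \<tau>) ^ 2)"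
    by (simp only: dedekind_eta_inversion[OF assms])
  hence "2 * ln (norm (dedekind_eta (- 1 / \<tau>))) = ln (norm \<tau>) + 2 * ln (norm (dedekind_eta \<tau>))"
    using nz eta_nz by (simp add: ln_mult ln_realpow)
  moreover have "ln (Im (- 1 / \<tau>)) = ln (Im \<tau>) - 2 * ln (norm \<tau>)"
    unfolding Im' using Im nz by (simp add: ln_div ln_realpow)
  ultimately show ?thesis
    unfolding eta_height_def H by (simp add: field_simps)
qed

text \<open>Euclid's algorithm on the first column: a translation by \<open>- n\<close> followed by
  inversion replaces \<open>(a, c)\<close> by \<open>(- c, a mod c)\<close>, which decreases the
  lower left entry in absolute value. When that entry is 0, the map is a translation.\<close>

lemma eta_height_moebius:
  assumes "\<gamma> \<in> SL2Z" "\<tau> \<in> upper_half_plane"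
  shows "eta_height (moebius \<gamma> \<tau>) = eta_height \<tau>"
proof -
  have "eta_height (moebius (a, b, c, d) \<tau>) = eta_height \<tau>" if "(a, b, c, d) \<in> SL2Z" for a b c d
    using that
  proof (induction "nat \<bar>c\<bar>" arbitrary: a b c d rule: less_induct)
    case less
    show ?case
    proof (cases "c = 0")
      case True
      hence "a * d = 1"
        using less.prems by (simp add: SL2Z_def)
      hence "a = 1 \<and> d = 1 \<or> a = -1 \<and> d = -1"
        by (auto simp: zmult_eq_1_iff)
      thus ?thesis
        using eta_height_translate[of \<tau> b] eta_height_translate[of \<tau> "- b"] True by auto
    next
      case False
      define n where "n = a div c"
      define r where "r = a - n * c"
      have r: "r = a mod c"
        by (simp add: r_def n_def minus_div_mult_eq_mod)
      have "(- c, - d, r, b - n * d) \<in> SL2Z"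
        using less.prems by (simp add: SL2Z_def r_def algebra_simps)
      moreover have "nat \<bar>r\<bar> < nat \<bar>c\<bar>"
        using False unfolding r by (simp add: abs_mod_less)
      ultimately have "eta_height \<tau> = eta_height (moebius (- c, - d, r, b - n * d) \<tau>)"
        by (intro less.hyps[symmetric])
      also have "moebius (- c, - d, r, b - n * d) \<tau> = - 1 / (moebius (a, b, c, d) \<tau> + of_int (- n))"
      proof -
        have "of_int c * \<tau> + of_int d \<noteq> 0"
          using automorphy_nonzero[OF less.prems assms(2)] by simp
        hence "moebius (a, b, c, d) \<tau> + of_int (- n) =
            (of_int r * \<tau> + of_int (b - n * d)) / (of_int c * \<tau> + of_int d)"
          by (simp add: r_def field_simps)
        thus ?thesis by (simp add: field_simps)
      qed
      also have "eta_height \<dots> = eta_height (moebius (a, b, c, d) \<tau>)"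
        using moebius_in_upper_half_plane[OF less.prems assms(2)]
        by (subst eta_height_inversion) (simp_all only: eta_height_translate, simp add: upper_half_plane_def)
      finally show ?thesis by simp
    qed
  qed
  thus ?thesis
    using assms(1) by (cases \<gamma>) auto
qed

text \<open>The linear term is the modulus of \<open>q^(1/24)\<close>. Since
  \<open>Im \<tau> \<ge> 1\<close> forces \<open>\<bar>q\<bar> \<le> 1/4\<close>, the logarithms of
  the product are dominated by a geometric series of sum 2.\<close>

lemma ln_eta_asymptotics:
  assumes "Im \<tau> \<ge> 1"
  shows "\<bar>Re (ln_eta \<tau>) + pi * Im \<tau> / 12\<bar> \<le> 2"
proof -
  have "norm (nome \<tau>) = exp (- (2 * pi * Im \<tau>))"
    by (rule norm_nome)
  also have "\<dots> \<le> exp (- 3)"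
  proof -
    have "2 * pi * Im \<tau> \<ge> 2 * pi * 1"
      using assms by (intro mult_left_mono) auto
    hence "3 \<le> 2 * pi * Im \<tau>"
      using pi_gt3 by linarith
    thus ?thesis by simp
  qed
  also have "\<dots> \<le> 1 / 4"
    using exp_ge_add_one_self[of 3] by (simp add: exp_minus field_simps)
  finally have q: "norm (nome \<tau>) \<le> 1 / 4" .
  have bound: "norm (Ln (1 - nome \<tau> ^ Suc n)) \<le> 2 * (1 / 2) ^ Suc n" for n
  proof -
    have le: "norm (nome \<tau> ^ Suc n) \<le> (1 / 4) ^ Suc n"
      unfolding norm_power by (intro power_mono q) auto
    have "(1 / 4 :: real) ^ Suc n \<le> (1 / 4) ^ 1"
      by (intro power_decreasing) auto
    with le have "norm (nome \<tau> ^ Suc n) < 1 / 2"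
      by simp
    hence "norm (Ln (1 + (- (nome \<tau> ^ Suc n)))) \<le> 2 * norm (- (nome \<tau> ^ Suc n))"
      by (intro norm_Ln_le) simp
    also have "norm (- (nome \<tau> ^ Suc n)) \<le> (1 / 2) ^ Suc n"
      using order_trans[OF le power_mono[of "1 / 4" "1 / 2" "Suc n"]] by simp
    finally show ?thesis by simp
  qed
  have sums: "(\<lambda>n. 2 * (1 / 2 :: real) ^ Suc n) sums 2"
    using sums_mult[OF power_half_series, of 2] by simp
  have "norm (\<Sum>n. Ln (1 - nome \<tau> ^ Suc n)) \<le> (\<Sum>n. 2 * (1 / 2 :: real) ^ Suc n)"
    by (intro norm_suminf_le bound sums_summable[OF sums])
  also have "\<dots> = 2"
    using sums by (simp add: sums_iff)
  finally have "\<bar>Re (\<Sum>n. Ln (1 - nome \<tau> ^ Suc n))\<bar> \<le> 2"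
    by (meson abs_Re_le_cmod order_trans)
  thus ?thesis
    by (simp add: ln_eta_def)
qed

text \<open>The matrix with rows \<open>(t, 0)\<close> and \<open>(0, 1)\<close> times \<open>\<gamma>\<close> equals \<open>\<gamma>'\<close> times an upper triangular
  matrix with diagonal \<open>A = gcd(t, c)\<close> and \<open>D = t / A\<close>.\<close>

lemma eta_height_cusp:
  fixes t :: nat
  assumes "t > 0" "(a, b, c, d) \<in> SL2Z"
  obtains C where "\<And>\<tau>. Im \<tau> \<ge> t \<Longrightarrow>
    \<bar>eta_height (of_nat t * moebius (a, b, c, d) \<tau>) -
      (ln (Im \<tau>) / 4 - pi * (real_of_int (gcd (int t) c))\<^sup>2 / (12 * t) * Im \<tau>)\<bar> \<le> C"
proof -
  have det: "a * d - b * c = 1"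
    using assms(2) by (simp add: SL2Z_def)
  define A where "A = gcd (int t) c"
  have "A > 0" using assms(1) by (simp add: A_def gcd_pos_int)
  obtain D where D: "int t = A * D" by (metis A_def gcd_dvd1 dvdE)
  have "D > 0" using D \<open>A > 0\<close> assms(1) by (metis of_nat_0_less_iff zero_less_mult_pos)
  obtain s where s: "c = A * s" by (metis A_def gcd_dvd2 dvdE)
  define p where "p = a * D"
  have "gcd (A * D) (A * s) = A"
    unfolding D[symmetric] s[symmetric] by (simp add: A_def)
  hence "A * gcd D s = A * 1"
    using gcd_mult_distrib_int[of A D s] \<open>A > 0\<close> by (simp only: abs_of_pos)
  hence "coprime D s"
    using \<open>A > 0\<close> unfolding coprime_iff_gcd_eq_1 by simp
  moreover have "coprime a s"
  proof (rule coprimeI)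
    fix x assume "x dvd a" "x dvd s"
    hence "x dvd a * d - b * c" by (simp add: s)
    thus "is_unit x" by (simp add: det)
  qed
  ultimately have "coprime p s"
    by (simp add: p_def)
  then obtain u r' where ur: "u * p + r' * s = 1"
    using bezout_int[of p s] by (auto simp: coprime_iff_gcd_eq_1)
  define r where "r = - r'"
  define \<gamma>' where "\<gamma>' = (p, r, s, u)"
  have \<gamma>': "\<gamma>' \<in> SL2Z"
    using ur by (simp add: \<gamma>'_def SL2Z_def r_def algebra_simps)
  have det': "p * u - r * s = 1"
    using \<gamma>' by (simp add: \<gamma>'_def SL2Z_def)
  \<comment> \<open>The upper right entry of the inverse of \<open>\<gamma>'\<close> times the
    matrix with rows \<open>(t a, t b)\<close> and \<open>(c, d)\<close>; \<open>pB\<close> and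
    \<open>sB\<close> verify the second column of the factorization.\<close>
  define B where "B = u * int t * b - r * d"
  have pB: "p * B + r * D = int t * b"
  proof -
    have "D = D * (a * d - b * c)" by (simp add: det)
    also have "\<dots> = p * d - s * int t * b" by (simp add: p_def s D algebra_simps)
    finally have "p * B + r * D = p * (u * int t * b - r * d) + r * (p * d - s * int t * b)"
      by (simp add: B_def)
    also have "\<dots> = (p * u - r * s) * (int t * b)"
      by (simp add: algebra_simps)
    finally show ?thesis by (simp add: det')
  qed
  have sB: "s * B + u * D = d"
  proof -
    have "D = D * (a * d - b * c)" by (simp add: det)
    also have "\<dots> = p * d - s * int t * b" by (simp add: p_def s D algebra_simps)
    finally have "s * B + u * D = s * (u * int t * b - r * d) + u * (p * d - s * int t * b)"
      by (simp add: B_def)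
    also have "\<dots> = (p * u - r * s) * d"
      by (simp add: algebra_simps)
    finally show ?thesis by (simp add: det')
  qed
  define z where "z = (\<lambda>\<tau>. (of_int A * \<tau> + of_int B) / (of_int D :: complex))"
  \<comment> \<open>As \<open>A / D = A\<^sup>2 / t\<close>, the square of the gcd appears here:
    this is the source of the gcd matrix.\<close>
  have Im_z: "Im (z \<tau>) = real_of_int A ^ 2 / t * Im \<tau>" for \<tau>
  proof -
    have "real t = real_of_int A * real_of_int D"
      using arg_cong[OF D, of real_of_int] by simp
    thus ?thesis
      using \<open>A > 0\<close> \<open>D > 0\<close> by (simp add: z_def power2_eq_square)
  qed
  have eq: "of_nat t * moebius (a, b, c, d) \<tau> = moebius \<gamma>' (z \<tau>)" for \<tau>
  proof -
    have 1: "(of_int p * z \<tau> + of_int r) = of_nat t * (of_int a * \<tau> + of_int b) / of_int D"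
    proof -
      have "of_int p * of_int B + of_int r * of_int D = (of_nat t * of_int b :: complex)"
        using arg_cong[OF pB, of complex_of_int] by simp
      moreover have "of_int p * of_int A = (of_nat t * of_int a :: complex)"
        using arg_cong[OF D, of complex_of_int] by (simp add: p_def)
      ultimately show ?thesis
        using \<open>D > 0\<close> by (simp add: z_def field_simps)
    qed
    have 2: "(of_int s * z \<tau> + of_int u) = (of_int c * \<tau> + of_int d) / of_int D"
    proof -
      have "of_int s * of_int B + of_int u * of_int D = (of_int d :: complex)"
        using arg_cong[OF sB, of complex_of_int] by simp
      moreover have "of_int s * of_int A = (of_int c :: complex)"
        by (simp add: s)
      ultimately show ?thesis
        using \<open>D > 0\<close> by (simp add: z_def field_simps)
    qed
    show ?thesis
      using \<open>D > 0\<close> by (simp add: \<gamma>'_def 1 2)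
  qed
  show ?thesis
  proof (rule that)
    fix \<tau> assume \<tau>: "Im \<tau> \<ge> t"
    have pos: "Im \<tau> > 0" using \<tau> assms(1) by linarith
    have "real_of_int A \<ge> 1" using \<open>A > 0\<close> by simp
    hence A1: "real_of_int A ^ 2 \<ge> 1" by (rule one_le_power)
    have "1 \<le> Im \<tau> / t" using \<tau> assms(1) by simp
    also have "\<dots> \<le> real_of_int A ^ 2 * (Im \<tau> / t)"
      using mult_right_mono[OF A1, of "Im \<tau> / t"] pos by simp
    finally have Im1: "Im (z \<tau>) \<ge> 1" by (simp add: Im_z)
    have "eta_height (of_nat t * moebius (a, b, c, d) \<tau>) = eta_height (z \<tau>)"
      unfolding eq using Im1 by (intro eta_height_moebius[OF \<gamma>'] upper_half_planeI) simp
    also have "\<dots> = Re (ln_eta (z \<tau>)) + (ln (real_of_int A ^ 2 / t) + ln (Im \<tau>)) / 4"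
    proof -
      have "real_of_int A ^ 2 / t > 0"
        using A1 assms(1) by (intro divide_pos_pos) linarith+
      thus ?thesis
        unfolding eta_height_def Im_z by (subst ln_mult) (use pos in auto)
    qed
    finally have eh: "eta_height (of_nat t * moebius (a, b, c, d) \<tau>) = \<dots>" .
    have "pi * (real_of_int A)\<^sup>2 / (12 * t) * Im \<tau> = pi * Im (z \<tau>) / 12"
      by (simp add: Im_z)
    hence diff: "eta_height (of_nat t * moebius (a, b, c, d) \<tau>) -
        (ln (Im \<tau>) / 4 - pi * (real_of_int A)\<^sup>2 / (12 * t) * Im \<tau>) =
        (Re (ln_eta (z \<tau>)) + pi * Im (z \<tau>) / 12) + ln (real_of_int A ^ 2 / t) / 4"
      unfolding eh by (simp only: add_divide_distrib)
    show "\<bar>eta_height (of_nat t * moebius (a, b, c, d) \<tau>) -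
      (ln (Im \<tau>) / 4 - pi * (real_of_int (gcd (int t) c))\<^sup>2 / (12 * t) * Im \<tau>)\<bar> \<le>
      2 + \<bar>ln (real_of_int A ^ 2 / t)\<bar> / 4"
      unfolding A_def[symmetric] diff using ln_eta_asymptotics[OF Im1]
        abs_triangle_ineq[of "Re (ln_eta (z \<tau>)) + pi * Im (z \<tau>) / 12" "ln (real_of_int A ^ 2 / t) / 4"]
      by simp
  qed
qed

text \<open>\<open>m\<close> is the order of \<open>g\<close> at 0. Once \<open>z^m\<close> is split
  off, the remaining holomorphic factor has no zero on a closed disc, so the logarithm of its
  modulus is bounded by compactness.\<close>

lemma meromorphic_log_growth:
  assumes "g meromorphic_on {0}" "\<exists>\<^sub>F z in at 0. g z \<noteq> 0"
  obtains m :: int and C r :: real where "r > 0"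
    "\<And>z. z \<noteq> 0 \<Longrightarrow> norm z \<le> r \<Longrightarrow> \<bar>ln (norm (g z)) - of_int m * ln (norm z)\<bar> \<le> C"
proof -
  define m where "m = zorder g 0"
  define h where "h = zor_poly g 0"
  have "isolated_singularity_at g 0" "not_essential g 0"
    using assms(1) by (auto intro: meromorphic_on_isolated_singularity meromorphic_on_not_essential)
  from zorder_exist[OF this assms(2)] obtain r where h0: "h 0 \<noteq> 0" and r: "r > 0" "h holomorphic_on cball 0 r"
    "\<And>z. z \<in> cball 0 r - {0} \<Longrightarrow> g z = h z * z powi m \<and> h z \<noteq> 0"
    by (auto simp: m_def h_def)
  have nz: "h z \<noteq> 0" if "z \<in> cball 0 r" for z
    using that r(3)[of z] h0 by (cases "z = 0") auto
  have "continuous_on (cball 0 r) (\<lambda>z. ln (norm (h z)))"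
    using nz by (intro continuous_intros holomorphic_on_imp_continuous_on r(2)) auto
  hence "compact ((\<lambda>z. ln (norm (h z))) ` cball 0 r)"
    by (intro compact_continuous_image) auto
  hence "bounded ((\<lambda>z. ln (norm (h z))) ` cball 0 r)"
    by (rule compact_imp_bounded)
  then obtain C where C: "\<And>z. z \<in> cball 0 r \<Longrightarrow> \<bar>ln (norm (h z))\<bar> \<le> C"
    unfolding bounded_iff by (metis imageI real_norm_def)
  show ?thesis
  proof (rule that[OF r(1)])
    fix z :: complex assume z: "z \<noteq> 0" "norm z \<le> r"
    hence zr: "z \<in> cball 0 r - {0}" by simp
    have "norm (g z) = norm (h z) * norm z powi m"
      using r(3)[OF zr] by (simp add: norm_mult norm_power_int)
    hence "ln (norm (g z)) = ln (norm (h z)) + ln (norm z powi m)"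
      using nz[of z] zr z by (simp add: ln_mult)
    also have "ln (norm z powi m) = of_int m * ln (norm z)"
      using z(1) by (simp add: ln_powr flip: powr_real_of_int')
    finally show "\<bar>ln (norm (g z)) - of_int m * ln (norm z)\<bar> \<le> C"
      using C[of z] zr by simp
  qed
qed

section \<open>A minimum principle for the modular curve\<close>

lemma open_upper_half_plane: "open upper_half_plane"
  unfolding upper_half_plane_def by (rule open_halfspace_Im_gt)

lemma convex_upper_half_plane: "convex upper_half_plane"
  unfolding upper_half_plane_def by (rule convex_halfspace_Im_gt)

lemma holomorphic_moebius:
  assumes "\<gamma> \<in> SL2Z"
  shows "moebius \<gamma> holomorphic_on upper_half_plane"
proof -
  obtain a b c d where \<gamma>: "\<gamma> = (a, b, c, d)" by (cases \<gamma>) auto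
  have "(\<lambda>\<tau>. (of_int a * \<tau> + of_int b) / (of_int c * \<tau> + of_int d)) holomorphic_on upper_half_plane"
    using automorphy_nonzero[OF assms] by (intro holomorphic_intros) (simp add: \<gamma>)
  thus ?thesis by (rule holomorphic_transform) (simp add: \<gamma>)
qed

text \<open>Phragmen-Lindeloef on a half-plane: the factor \<open>exp (i \<epsilon> \<tau>)\<close> moves the maximum to the boundary line.\<close>

lemma periodic_maximum_on_line:
  fixes K :: "complex \<Rightarrow> complex" and p y0 :: real
  assumes K: "K holomorphic_on S" "open S" "{\<tau>. Im \<tau> \<ge> y0} \<subseteq> S"
    and nz: "\<And>\<tau>. Im \<tau> \<ge> y0 \<Longrightarrow> K \<tau> \<noteq> 0"
    and p: "p > 0" and per: "\<And>\<tau>. Im \<tau> \<ge> y0 \<Longrightarrow> norm (K (\<tau> + of_real p)) = norm (K \<tau>)"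
    and bd: "\<And>\<tau>. Im \<tau> \<ge> Y \<Longrightarrow> norm (K \<tau>) \<le> C"
  obtains \<sigma> where "Im \<sigma> = y0" "\<And>\<tau>. Im \<tau> \<ge> y0 \<Longrightarrow> norm (K \<tau>) \<le> norm (K \<sigma>)"
proof -
  have contK: "continuous_on {\<tau>. Im \<tau> \<ge> y0} K"
    using holomorphic_on_imp_continuous_on[OF K(1)] K(3) continuous_on_subset by blast
  have per_nat: "norm (K (\<tau> + of_real (of_nat n * p))) = norm (K \<tau>)" if "Im \<tau> \<ge> y0" for \<tau> n
  proof (induction n)
    case (Suc n)
    show ?case
      using per[of "\<tau> + of_real (of_nat n * p)"] that Suc by (simp add: algebra_simps)
  qed auto
  have per_int: "norm (K (\<tau> + of_real (of_int n * p))) = norm (K \<tau>)" if "Im \<tau> \<ge> y0" for \<tau> n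
  proof (cases "n \<ge> 0")
    case True
    thus ?thesis using per_nat[OF that, of "nat n"] by simp
  next
    case False
    thus ?thesis using per_nat[of "\<tau> + of_real (of_int n * p)" "nat (- n)"] that by (simp add: algebra_simps)
  qed
  have reduce: "\<exists>\<tau>'. Im \<tau>' = Im \<tau> \<and> Re \<tau>' \<in> {0..p} \<and> norm (K \<tau>') = norm (K \<tau>)" if "Im \<tau> \<ge> y0" for \<tau>
  proof -
    define n where "n = \<lfloor>Re \<tau> / p\<rfloor>"
    have "of_int n \<le> Re \<tau> / p" "Re \<tau> / p < of_int n + 1"
      unfolding n_def by linarith+
    hence "of_int n * p \<le> Re \<tau>" "Re \<tau> \<le> of_int n * p + p"
      using p by (simp_all add: field_simps)
    thus ?thesis
      using per_int[OF that, of "- n"] by (intro exI[of _ "\<tau> + of_real (of_int (- n) * p)"]) simp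
  qed
  define Q where "Q = (\<lambda>Y'. cbox (Complex 0 y0) (Complex p Y'))"
  have Q: "\<tau> \<in> Q Y' \<longleftrightarrow> Re \<tau> \<in> {0..p} \<and> Im \<tau> \<in> {y0..Y'}" for \<tau> Y'
    by (auto simp: Q_def in_cbox_complex_iff)
  have Qmax: "\<exists>\<sigma>\<in>Q Y'. \<forall>\<tau>\<in>Q Y'. norm (G \<tau>) \<le> norm (G \<sigma>)"
    if "Y' \<ge> y0" "continuous_on {\<tau>. Im \<tau> \<ge> y0} G" for Y' and G :: "complex \<Rightarrow> complex"
  proof (rule continuous_attains_sup)
    show "compact (Q Y')" by (simp add: Q_def)
    have "Complex 0 y0 \<in> Q Y'" using p that(1) by (simp add: Q)
    thus "Q Y' \<noteq> {}" by blast
    have "Q Y' \<subseteq> {\<tau>. Im \<tau> \<ge> y0}" by (auto simp: Q)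
    thus "continuous_on (Q Y') (\<lambda>\<tau>. norm (G \<tau>))"
      by (intro continuous_intros continuous_on_subset[OF that(2)])
  qed
  \<comment> \<open>For \<open>Y' = y0\<close> the rectangle degenerates to one period of the
    boundary line.\<close>
  from Qmax[OF order_refl contK] obtain \<sigma> where \<sigma>: "\<sigma> \<in> Q y0" "\<And>\<tau>. \<tau> \<in> Q y0 \<Longrightarrow> norm (K \<tau>) \<le> norm (K \<sigma>)"
    by blast
  have line: "norm (K \<tau>) \<le> norm (K \<sigma>)" if "Im \<tau> = y0" for \<tau>
    using reduce[of \<tau>] \<sigma>(2) that by (metis Q atLeastAtMost_iff order_refl)
  have main: "norm (K \<tau>) \<le> norm (K \<sigma>) * exp (\<epsilon> * (Im \<tau> - y0))" if "Im \<tau> \<ge> y0" "\<epsilon> > 0" for \<tau> \<epsilon>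
  proof -
    define G where "G = (\<lambda>\<tau>. K \<tau> * exp (\<i> * of_real \<epsilon> * \<tau>))"
    have norm_G: "norm (G \<tau>) = norm (K \<tau>) * exp (- (\<epsilon> * Im \<tau>))" for \<tau>
      by (simp add: G_def norm_mult)
    have holG: "G holomorphic_on S"
      unfolding G_def by (intro holomorphic_intros K)
    have contG: "continuous_on {\<tau>. Im \<tau> \<ge> y0} G"
      unfolding G_def by (intro continuous_intros contK)
    \<comment> \<open>A reference value of \<open>\<bar>G\<bar>\<close> on the boundary line. Above
      the height \<open>Y'\<close> chosen below, \<open>\<bar>G\<bar>\<close> stays smaller than
      \<open>v\<close>, so a maximum over the compact rectangle is a maximum over the whole
      half-plane.\<close>
    define v where "v = norm (G (Complex 0 y0))"
    have "v > 0" unfolding v_def using nz[of "Complex 0 y0"] by (simp add: G_def)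
    have "((\<lambda>y. C * exp (- (\<epsilon> * y))) \<longlongrightarrow> C * 0) at_top"
      using that(2) by (intro tendsto_intros filterlim_compose[OF exp_at_bot]
        filterlim_compose[OF filterlim_uminus_at_bot_at_top] filterlim_tendsto_pos_mult_at_top[OF tendsto_const]
        filterlim_ident) auto
    hence "eventually (\<lambda>y. C * exp (- (\<epsilon> * y)) < v) at_top"
      using \<open>v > 0\<close> by (auto intro: order_tendstoD(2))
    then obtain Y2 where Y2: "\<And>y. y \<ge> Y2 \<Longrightarrow> C * exp (- (\<epsilon> * y)) < v"
      by (auto simp: eventually_at_top_linorder)
    define Y' where "Y' = max y0 (max Y Y2)"
    have decay: "norm (G \<tau>) < v" if "Im \<tau> \<ge> Y'" for \<tau>
    proof -
      have "norm (G \<tau>) \<le> C * exp (- (\<epsilon> * Im \<tau>))"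
        unfolding norm_G using that by (intro mult_right_mono bd) (auto simp: Y'_def)
      also have "\<dots> < v" using that by (intro Y2) (simp add: Y'_def)
      finally show ?thesis .
    qed
    obtain \<rho> where \<rho>: "\<rho> \<in> Q Y'" "\<And>\<tau>. \<tau> \<in> Q Y' \<Longrightarrow> norm (G \<tau>) \<le> norm (G \<rho>)"
      using Qmax[OF _ contG, of Y'] by (auto simp: Y'_def)
    have "v \<le> norm (G \<rho>)"
      unfolding v_def using p by (intro \<rho>(2)) (simp add: Q Y'_def)
    have max: "norm (G \<tau>) \<le> norm (G \<rho>)" if \<tau>: "Im \<tau> \<ge> y0" for \<tau>
    proof (cases "Im \<tau> \<ge> Y'")
      case True
      thus ?thesis using decay[OF True] \<open>v \<le> norm (G \<rho>)\<close> by simp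
    next
      case False
      obtain \<tau>' where "Im \<tau>' = Im \<tau>" "Re \<tau>' \<in> {0..p}" "norm (K \<tau>') = norm (K \<tau>)"
        using reduce[OF \<tau>] by blast
      thus ?thesis using \<rho>(2)[of \<tau>'] \<tau> False by (simp add: Q norm_G)
    qed
    \<comment> \<open>A maximum in the open half-plane would make \<open>G\<close> constant there,
      against its decay below \<open>v\<close>.\<close>
    have "Im \<rho> = y0"
    proof (rule ccontr)
      assume "Im \<rho> \<noteq> y0"
      hence \<rho>_in: "Im \<rho> > y0" using \<rho>(1) by (auto simp: Q)
      have "G constant_on {\<tau>. Im \<tau> > y0}"
      proof (rule maximum_modulus_principle)
        show "G holomorphic_on {\<tau>. Im \<tau> > y0}"
          by (rule holomorphic_on_subset[OF holG]) (use K(3) in auto)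
        show "open {\<tau>. Im \<tau> > y0}" by (rule open_halfspace_Im_gt)
        thus "open {\<tau>. Im \<tau> > y0}" .
        show "connected {\<tau>. Im \<tau> > y0}"
          by (intro convex_connected convex_halfspace_Im_gt)
        show "\<rho> \<in> {\<tau>. Im \<tau> > y0}" using \<rho>_in by simp
      qed (use max in auto)
      moreover have "Complex 0 (Y' + 1) \<in> {\<tau>. Im \<tau> > y0}" "\<rho> \<in> {\<tau>. Im \<tau> > y0}"
        using \<rho>_in by (auto simp: Y'_def)
      ultimately have "G (Complex 0 (Y' + 1)) = G \<rho>"
        unfolding constant_on_def by metis
      thus False
        using decay[of "Complex 0 (Y' + 1)"] \<open>v \<le> norm (G \<rho>)\<close> by simp
    qed
    hence "norm (G \<rho>) \<le> norm (K \<sigma>) * exp (- (\<epsilon> * y0))"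
      unfolding norm_G using line[of \<rho>] by simp
    hence "norm (K \<tau>) * exp (- (\<epsilon> * Im \<tau>)) \<le> norm (K \<sigma>) * exp (- (\<epsilon> * y0))"
      using max[OF that(1)] by (simp add: norm_G)
    hence "norm (K \<tau>) * exp (- (\<epsilon> * Im \<tau>)) * exp (\<epsilon> * Im \<tau>) \<le>
        norm (K \<sigma>) * exp (- (\<epsilon> * y0)) * exp (\<epsilon> * Im \<tau>)"
      by (rule mult_right_mono) simp
    thus ?thesis
      by (simp add: mult.assoc algebra_simps flip: exp_add)
  qed
  show ?thesis
  proof (rule that[of \<sigma>])
    show "Im \<sigma> = y0" using \<sigma>(1) by (auto simp: Q)
    fix \<tau> assume \<tau>: "Im \<tau> \<ge> y0"
    show "norm (K \<tau>) \<le> norm (K \<sigma>)"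
    proof (rule tendsto_lowerbound)
      have "((\<lambda>\<epsilon>. norm (K \<sigma>) * exp (\<epsilon> * (Im \<tau> - y0))) \<longlongrightarrow> norm (K \<sigma>) * exp (0 * (Im \<tau> - y0))) (at_right 0)"
        by (intro tendsto_intros)
      thus "((\<lambda>\<epsilon>. norm (K \<sigma>) * exp (\<epsilon> * (Im \<tau> - y0))) \<longlongrightarrow> norm (K \<sigma>)) (at_right 0)"
        by simp
      show "\<forall>\<^sub>F \<epsilon> in at_right 0. norm (K \<tau>) \<le> norm (K \<sigma>) * exp (\<epsilon> * (Im \<tau> - y0))"
        using main[OF \<tau>] by (auto simp: eventually_at_filter)
    qed simp
  qed
qed

text \<open>Two matrices of \<open>SL\<^sub>2(\<int>)\<close> that agree modulo \<open>N\<close> lie in the same coset of \<open>\<Gamma>\<^sub>0(N)\<close>.\<close>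

lemma Gamma0_finite_index:
  assumes "N > 0"
  obtains R where "finite R" "R \<subseteq> SL2Z"
    "\<And>\<gamma>. \<gamma> \<in> SL2Z \<Longrightarrow> \<exists>\<delta>\<in>Gamma0 N. \<exists>\<rho>\<in>R. \<gamma> = mat2_mult \<delta> \<rho>"
proof -
  define red where "red = (\<lambda>(a, b, c, d). (a mod int N, b mod int N, c mod int N, d mod int N))"
  define I where "I = {0..<int N}"
  have sub: "red ` SL2Z \<subseteq> I \<times> I \<times> I \<times> I"
    using assms by (auto simp: red_def I_def)
  have fin: "finite (red ` SL2Z)"
    by (rule finite_subset[OF sub]) (simp add: I_def)
  define R where "R = (inv_into SL2Z red) ` (red ` SL2Z)"
  show ?thesis
  proof (rule that[of R])
    show "finite R" unfolding R_def using fin by simp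
    show RSL: "R \<subseteq> SL2Z" unfolding R_def by (rule image_subsetI, rule inv_into_into)
    fix \<gamma> assume \<gamma>: "\<gamma> \<in> SL2Z"
    define \<rho> where "\<rho> = inv_into SL2Z red (red \<gamma>)"
    have \<rho>: "\<rho> \<in> R" using \<gamma> by (simp add: R_def \<rho>_def)
    hence \<rho>_SL: "\<rho> \<in> SL2Z" using RSL by blast
    have eq: "red \<rho> = red \<gamma>" unfolding \<rho>_def using \<gamma> by (simp add: f_inv_into_f)
    obtain a b c d where g: "\<gamma> = (a, b, c, d)" by (cases \<gamma>) auto
    obtain p q r s where r: "\<rho> = (p, q, r, s)" by (cases \<rho>) auto
    have det: "a * d - b * c = 1" "p * s - q * r = 1"
      using \<gamma> \<rho>_SL by (auto simp: g r SL2Z_def)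
    have "r mod int N = c mod int N" "s mod int N = d mod int N"
      using eq by (auto simp: red_def g r)
    hence rs: "int N dvd c - r" "int N dvd d - s"
      by (auto simp: mod_eq_dvd_iff dvd_diff_commute)
    define \<delta> where "\<delta> = mat2_mult \<gamma> (s, - q, - r, p)"
    have "(s, - q, - r, p) \<in> SL2Z" using det(2) by (simp add: SL2Z_def algebra_simps)
    hence "\<delta> \<in> SL2Z" unfolding \<delta>_def by (rule mat2_mult_in_SL2Z[OF \<gamma>])
    moreover have "int N dvd c * s - d * r"
    proof -
      have "c * s - d * r = (c - r) * s - (d - s) * r" by (simp add: algebra_simps)
      thus ?thesis using rs by (simp add: dvd_diff)
    qed
    ultimately have "\<delta> \<in> Gamma0 N" by (simp add: Gamma0_def \<delta>_def g)
    moreover have "mat2_mult \<delta> \<rho> = \<gamma>"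
    proof -
      have "x * s * p - x * q * r = x" "x * p * s - x * r * q = x" for x :: int
        using arg_cong[OF det(2), of "\<lambda>y. x * y"] by (simp_all add: algebra_simps)
      thus ?thesis by (simp add: \<delta>_def g r algebra_simps)
    qed
    ultimately show "\<exists>\<delta>\<in>Gamma0 N. \<exists>\<rho>\<in>R. \<gamma> = mat2_mult \<delta> \<rho>"
      using \<rho> by blast
  qed
qed

lemma Gamma0_subset_SL2Z: "\<gamma> \<in> Gamma0 N \<Longrightarrow> \<gamma> \<in> SL2Z"
  by (auto simp: Gamma0_def)

text \<open>At a minimum \<open>\<tau>0\<close> of \<open>\<bar>G\<bar> y\<^sup>w\<close> the function \<open>G\<inverse> (\<tau> - cnj \<tau>0)\<^sup>-\<^sup>2\<^sup>w\<close> has a maximum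
  modulus, because \<open>4 y y0 \<le> \<bar>\<tau> - cnj \<tau>0\<bar>\<^sup>2\<close> with equality at \<open>\<tau>0\<close>.\<close>

lemma weighted_minimum_imp_constant:
  fixes G :: "complex \<Rightarrow> complex" and w :: real
  assumes G: "G holomorphic_on upper_half_plane" "\<And>\<tau>. \<tau> \<in> upper_half_plane \<Longrightarrow> G \<tau> \<noteq> 0"
    and w: "w \<ge> 0" and \<tau>0: "\<tau>0 \<in> upper_half_plane"
    and min: "\<And>\<tau>. \<tau> \<in> upper_half_plane \<Longrightarrow>
      ln (norm (G \<tau>0)) + w * ln (Im \<tau>0) \<le> ln (norm (G \<tau>)) + w * ln (Im \<tau>)"
  shows "G constant_on upper_half_plane"
proof -
  define y0 where "y0 = Im \<tau>0"
  have y0: "y0 > 0" using \<tau>0 by (simp add: y0_def upper_half_plane_def)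
  \<comment> \<open>The factor \<open>- \<i>\<close> rotates \<open>\<tau> - cnj \<tau>0\<close>
    into the right half-plane, where the principal logarithm is holomorphic.\<close>
  define L where "L = (\<lambda>\<tau>. Ln (- \<i> * (\<tau> - cnj \<tau>0)))"
  have Re_pos: "Re (- \<i> * (\<tau> - cnj \<tau>0)) > 0" if "\<tau> \<in> upper_half_plane" for \<tau>
    using that y0 by (simp add: upper_half_plane_def y0_def)
  have notin: "- \<i> * (\<tau> - cnj \<tau>0) \<notin> \<real>\<^sub>\<le>\<^sub>0" if "\<tau> \<in> upper_half_plane" for \<tau>
    using Re_pos[OF that] by (auto simp only: complex_nonpos_Reals_iff)
  have nz: "- \<i> * (\<tau> - cnj \<tau>0) \<noteq> 0" if "\<tau> \<in> upper_half_plane" for \<tau>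
    using notin[OF that] by auto
  have Re_L: "Re (L \<tau>) = ln (norm (\<tau> - cnj \<tau>0))" if "\<tau> \<in> upper_half_plane" for \<tau>
    unfolding L_def using nz[OF that] by (subst Re_Ln) (auto simp: norm_mult)
  define h where "h = (\<lambda>\<tau>. exp (- (2 * of_real w * L \<tau>)) / G \<tau>)"
  have holh: "h holomorphic_on upper_half_plane"
    unfolding h_def L_def using notin G by (intro holomorphic_intros) auto
  have hnz: "h \<tau> \<noteq> 0" if "\<tau> \<in> upper_half_plane" for \<tau>
    using G(2)[OF that] by (simp add: h_def)
  have ln_h: "ln (norm (h \<tau>)) = - ln (norm (G \<tau>)) - 2 * w * ln (norm (\<tau> - cnj \<tau>0))"
    if "\<tau> \<in> upper_half_plane" for \<tau>
    using G(2)[OF that] Re_L[OF that] by (simp add: h_def norm_divide ln_div)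
  have norm0: "norm (\<tau>0 - cnj \<tau>0) = 2 * y0"
    using y0 by (simp add: complex_diff_cnj norm_mult y0_def)
  have ineq: "ln (Im \<tau>) + ln y0 + 2 * ln 2 \<le> 2 * ln (norm (\<tau> - cnj \<tau>0))" if "\<tau> \<in> upper_half_plane" for \<tau>
  proof -
    have y: "Im \<tau> > 0" using that by (rule upper_half_planeD)
    have "norm (\<tau> - cnj \<tau>0) ^ 2 = (Re \<tau> - Re \<tau>0) ^ 2 + (Im \<tau> + y0) ^ 2"
      by (simp add: cmod_power2 y0_def)
    also have "(Im \<tau> + y0) ^ 2 = (Im \<tau> - y0) ^ 2 + Im \<tau> * y0 * 2 ^ 2"
      by (simp add: power2_eq_square algebra_simps)
    finally have "Im \<tau> * y0 * 2 ^ 2 \<le> norm (\<tau> - cnj \<tau>0) ^ 2"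
      by simp
    hence "ln (Im \<tau> * y0 * 2 ^ 2) \<le> ln (norm (\<tau> - cnj \<tau>0) ^ 2)"
      using y y0 by (intro ln_mono) auto
    moreover have "ln 4 = 2 * ln (2 :: real)"
      using ln_realpow[of 2 2] by simp
    ultimately show ?thesis
      using y y0 nz[OF that] by (simp add: ln_mult ln_realpow)
  qed
  have le: "norm (h \<tau>) \<le> norm (h \<tau>0)" if "\<tau> \<in> upper_half_plane" for \<tau>
  proof -
    have "w * (ln (Im \<tau>) + ln y0 + 2 * ln 2) \<le> w * (2 * ln (norm (\<tau> - cnj \<tau>0)))"
      by (rule mult_left_mono[OF ineq[OF that] w])
    hence "ln (norm (h \<tau>)) \<le> ln (norm (h \<tau>0))"
      using min[OF that] y0
      unfolding ln_h[OF that] ln_h[OF \<tau>0] norm0 y0_def[symmetric] by (simp add: ln_mult algebra_simps)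
    thus ?thesis using hnz[OF that] hnz[OF \<tau>0] by simp
  qed
  have "h constant_on upper_half_plane"
    by (rule maximum_modulus_principle[OF holh open_upper_half_plane _ open_upper_half_plane order_refl \<tau>0 le])
       (auto intro: convex_connected convex_upper_half_plane)
  then obtain c where c: "\<And>\<tau>. \<tau> \<in> upper_half_plane \<Longrightarrow> h \<tau> = c"
    by (auto simp: constant_on_def)
  \<comment> \<open>A test point above \<open>\<tau>0\<close> at twice its height. There
    \<open>h\<close>, being constant, would force \<open>w * (2 ln 3 - 3 ln 2) \<le> 0\<close>; as
    \<open>2^3 < 3^2\<close>, this leaves only \<open>w = 0\<close>.\<close>
  define \<tau>1 where "\<tau>1 = \<tau>0 + \<i> * of_real y0"
  have \<tau>1: "\<tau>1 \<in> upper_half_plane" and Im1: "Im \<tau>1 = 2 * y0"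
    using y0 by (auto simp: \<tau>1_def upper_half_plane_def y0_def)
  have "\<tau>1 - cnj \<tau>0 = \<i> * of_real (3 * y0)"
    by (simp add: \<tau>1_def complex_eq_iff y0_def)
  hence norm1: "norm (\<tau>1 - cnj \<tau>0) = 3 * y0"
    using y0 by (simp add: norm_mult)
  have "ln (norm (h \<tau>1)) = ln (norm (h \<tau>0))"
    using c[OF \<tau>1] c[OF \<tau>0] by simp
  hence "2 * w * ln 3 \<le> w * (3 * ln 2)"
    using min[OF \<tau>1] y0
    unfolding ln_h[OF \<tau>1] ln_h[OF \<tau>0] norm0 norm1 Im1 y0_def[symmetric] by (simp add: ln_mult algebra_simps)
  moreover have "3 * ln 2 < 2 * ln (3 :: real)"
  proof -
    have "ln (2 ^ 3) < ln (3 ^ 2 :: real)" by simp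
    thus ?thesis by (simp only: ln_realpow)
  qed
  ultimately have "w = 0"
    using w mult_strict_left_mono[of "3 * ln 2" "2 * ln (3 :: real)" w] by (cases "w = 0") auto
  hence "G \<tau> = 1 / c" if "\<tau> \<in> upper_half_plane" for \<tau>
    using c[OF that] G(2)[OF that] by (auto simp: h_def)
  thus ?thesis by (auto simp: constant_on_def)
qed

text \<open>Near each cusp, \<open>\<Psi>\<close> differs from \<open>w ln (Im \<tau>)\<close> by a
  bounded amount, so for \<open>w \<ge> 0\<close> it is not lower high up than on a fixed line. The
  minima on these lines for finitely many coset representatives are compared, and the least is a
  global minimum.\<close>

lemma rigidity_nonneg:
  fixes G :: "complex \<Rightarrow> complex" and w :: real
  assumes N: "N > 0"
    and G: "G holomorphic_on upper_half_plane" "\<And>\<tau>. \<tau> \<in> upper_half_plane \<Longrightarrow> G \<tau> \<noteq> 0"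
    and w: "w \<ge> 0"
    and inv: "\<And>\<gamma> \<tau>. \<gamma> \<in> Gamma0 N \<Longrightarrow> \<tau> \<in> upper_half_plane \<Longrightarrow>
      ln (norm (G (moebius \<gamma> \<tau>))) + w * ln (Im (moebius \<gamma> \<tau>)) = ln (norm (G \<tau>)) + w * ln (Im \<tau>)"
    and cusp: "\<And>\<gamma>. \<gamma> \<in> SL2Z \<Longrightarrow> \<exists>C Y. \<forall>\<tau>. Im \<tau> > 0 \<and> Im \<tau> \<ge> Y \<longrightarrow>
      \<bar>ln (norm (G (moebius \<gamma> \<tau>))) + w * ln (Im (moebius \<gamma> \<tau>)) - w * ln (Im \<tau>)\<bar> \<le> C"
  shows "G constant_on upper_half_plane"
proof -
  define \<Psi> where "\<Psi> = (\<lambda>\<tau>. ln (norm (G \<tau>)) + w * ln (Im \<tau>))"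
  have cusp_min: "\<exists>\<sigma>. Im \<sigma> = 1 / 2 \<and> (\<forall>\<tau>. Im \<tau> \<ge> 1 / 2 \<longrightarrow> \<Psi> (moebius \<gamma> \<sigma>) \<le> \<Psi> (moebius \<gamma> \<tau>))"
    if \<gamma>: "\<gamma> \<in> SL2Z" for \<gamma>
  proof -
    obtain a b c d where g: "\<gamma> = (a, b, c, d)" by (cases \<gamma>) auto
    have "automorphy \<gamma> holomorphic_on upper_half_plane"
    proof -
      have "(\<lambda>\<tau>. of_int c * \<tau> + of_int d) holomorphic_on upper_half_plane"
        by (intro holomorphic_intros)
      thus ?thesis by (rule holomorphic_transform) (simp add: g)
    qed
    \<comment> \<open>The power \<open>2 * w\<close> of the automorphy factor has a real exponent,
      so a holomorphic logarithm is needed.\<close>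
    then obtain L where L: "L holomorphic_on upper_half_plane"
      "\<And>\<tau>. \<tau> \<in> upper_half_plane \<Longrightarrow> automorphy \<gamma> \<tau> = exp (L \<tau>)"
      using contractible_imp_holomorphic_log[OF _ convex_imp_contractible[OF convex_upper_half_plane]]
        automorphy_nonzero[OF \<gamma>] by (metis (no_types, lifting))
    \<comment> \<open>Chosen so that \<open>\<bar>K \<tau>\<bar>\<close> is
      \<open>(Im \<tau>)^w\<close> divided by \<open>exp (\<Psi> (moebius \<gamma> \<tau>))\<close>:
      bounded high up by the cusp condition, and large where \<open>\<Psi>\<close> is small.\<close>
    define K where "K = (\<lambda>\<tau>. exp (2 * of_real w * L \<tau>) / G (moebius \<gamma> \<tau>))"
    note mH = moebius_in_upper_half_plane[OF \<gamma>]
    have holK: "K holomorphic_on upper_half_plane"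
      unfolding K_def
      by (intro holomorphic_intros L holomorphic_on_compose_gen[OF holomorphic_moebius[OF \<gamma>] G(1), unfolded o_def])
         (use G(2) mH in auto)
    have Knz: "K \<tau> \<noteq> 0" if "\<tau> \<in> upper_half_plane" for \<tau>
      using G(2) mH[OF that] by (simp add: K_def)
    have ln_K: "ln (norm (K \<tau>)) = w * ln (Im \<tau>) - \<Psi> (moebius \<gamma> \<tau>)" if "\<tau> \<in> upper_half_plane" for \<tau>
    proof -
      have im: "ln (Im (moebius \<gamma> \<tau>)) = ln (Im \<tau>) - 2 * Re (L \<tau>)"
        unfolding Im_moebius[OF \<gamma> that] L(2)[OF that]
        using upper_half_planeD[OF that] by (simp add: ln_div ln_realpow)
      have "ln (norm (K \<tau>)) = 2 * w * Re (L \<tau>) - ln (norm (G (moebius \<gamma> \<tau>)))"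
        using G(2)[OF mH[OF that]] by (simp add: K_def norm_divide ln_div)
      thus ?thesis unfolding \<Psi>_def im by (simp add: algebra_simps)
    qed
    have half: "\<tau> \<in> upper_half_plane" if "Im \<tau> \<ge> 1 / 2" for \<tau>
      using that by (simp add: upper_half_plane_def)
    obtain C Y where CY: "\<And>\<tau>. Im \<tau> > 0 \<Longrightarrow> Im \<tau> \<ge> Y \<Longrightarrow> \<bar>\<Psi> (moebius \<gamma> \<tau>) - w * ln (Im \<tau>)\<bar> \<le> C"
      using cusp[OF \<gamma>] unfolding \<Psi>_def by blast
    obtain \<sigma> where \<sigma>: "Im \<sigma> = 1 / 2" "\<And>\<tau>. Im \<tau> \<ge> 1 / 2 \<Longrightarrow> norm (K \<tau>) \<le> norm (K \<sigma>)"
    proof (rule periodic_maximum_on_line[OF holK open_upper_half_plane, of "1 / 2" "real N" "max 1 Y" "exp C"])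
      show "norm (K (\<tau> + of_real (real N))) = norm (K \<tau>)" if "Im \<tau> \<ge> 1 / 2" for \<tau>
      proof -
        define \<tau>' where "\<tau>' = \<tau> + of_real (real N)"
        have H: "\<tau> \<in> upper_half_plane" "\<tau>' \<in> upper_half_plane"
          using that by (auto simp: upper_half_plane_def \<tau>'_def)
        define T where "T = (1 :: int, int N, 0 :: int, 1 :: int)"
        \<comment> \<open>This is \<open>\<gamma> T \<gamma>\<inverse>\<close>, whose lower left
          entry is a multiple of \<open>N\<close>; so \<open>N\<close> is a period of
          \<open>\<bar>K\<bar>\<close> at every cusp, whatever its width.\<close>
        define \<delta> where "\<delta> = (1 - a * c * int N, a * a * int N, - (c * c * int N), 1 + a * c * int N)"
        have T: "T \<in> SL2Z" by (simp add: T_def SL2Z_def)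
        have \<delta>: "\<delta> \<in> Gamma0 N"
          by (simp add: \<delta>_def Gamma0_def SL2Z_def algebra_simps)
        have det: "a * d - b * c = 1" using \<gamma> by (simp add: g SL2Z_def)
        have "mat2_mult \<gamma> T = mat2_mult \<delta> \<gamma>"
        proof -
          have bc: "b * c = a * d - 1" using det by simp
          have "a * int N + b = (1 - a * c * int N) * b + a * a * int N * d"
            using arg_cong[OF bc, of "\<lambda>x. a * int N * x"] by (simp add: algebra_simps)
          moreover have "c * int N + d = - (c * c * int N) * b + (1 + a * c * int N) * d"
            using arg_cong[OF bc, of "\<lambda>x. c * int N * x"] by (simp add: algebra_simps)
          ultimately show ?thesis
            by (simp add: g T_def \<delta>_def algebra_simps)
        qed
        moreover have "\<tau>' = moebius T \<tau>" by (simp add: T_def \<tau>'_def)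
        ultimately have "moebius \<gamma> \<tau>' = moebius \<delta> (moebius \<gamma> \<tau>)"
          using moebius_mat2_mult[OF \<gamma> T H(1)] moebius_mat2_mult[OF Gamma0_subset_SL2Z[OF \<delta>] \<gamma> H(1)] by simp
        hence "\<Psi> (moebius \<gamma> \<tau>') = \<Psi> (moebius \<gamma> \<tau>)"
          using inv[OF \<delta> mH[OF H(1)]] by (simp add: \<Psi>_def)
        hence "ln (norm (K \<tau>')) = ln (norm (K \<tau>))"
          using ln_K[OF H(1)] ln_K[OF H(2)] by (simp add: \<tau>'_def)
        thus ?thesis
          using Knz[OF H(1)] Knz[OF H(2)] by (simp add: \<tau>'_def)
      qed
      show "norm (K \<tau>) \<le> exp C" if "Im \<tau> \<ge> max 1 Y" for \<tau>
      proof -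
        have H: "\<tau> \<in> upper_half_plane" using that by (simp add: upper_half_plane_def)
        hence "ln (norm (K \<tau>)) \<le> C"
          using CY[of \<tau>] ln_K[OF H] that by simp
        thus ?thesis using Knz[OF H] by (metis exp_le_cancel_iff exp_ln zero_less_norm_iff)
      qed
    qed (use half Knz N in auto)
    have "\<Psi> (moebius \<gamma> \<sigma>) \<le> \<Psi> (moebius \<gamma> \<tau>)" if "Im \<tau> \<ge> 1 / 2" for \<tau>
    proof -
      have H: "\<tau> \<in> upper_half_plane" "\<sigma> \<in> upper_half_plane"
        using that \<sigma>(1) by (auto simp: upper_half_plane_def)
      have "ln (norm (K \<tau>)) \<le> ln (norm (K \<sigma>))"
        using \<sigma>(2)[OF that] Knz[OF H(1)] by (intro ln_mono) auto
      \<comment> \<open>The sign of \<open>w\<close> matters here: \<open>(Im \<tau>)^w\<close> is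
        least on the boundary line, so a maximum of \<open>\<bar>K\<bar>\<close> on the line gives a
        minimum of \<open>\<Psi>\<close>.\<close>
      moreover have "w * ln (Im \<sigma>) \<le> w * ln (Im \<tau>)"
        using w that \<sigma>(1) by (intro mult_left_mono) auto
      ultimately show ?thesis using ln_K[OF H(1)] ln_K[OF H(2)] by simp
    qed
    thus ?thesis using \<sigma>(1) by blast
  qed
  then obtain \<sigma> where \<sigma>: "\<And>\<gamma>. \<gamma> \<in> SL2Z \<Longrightarrow> Im (\<sigma> \<gamma>) = 1 / 2"
    "\<And>\<gamma> \<tau>. \<gamma> \<in> SL2Z \<Longrightarrow> Im \<tau> \<ge> 1 / 2 \<Longrightarrow> \<Psi> (moebius \<gamma> (\<sigma> \<gamma>)) \<le> \<Psi> (moebius \<gamma> \<tau>)"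
    by metis
  obtain R where R: "finite R" "R \<subseteq> SL2Z"
    "\<And>\<gamma>. \<gamma> \<in> SL2Z \<Longrightarrow> \<exists>\<delta>\<in>Gamma0 N. \<exists>\<rho>\<in>R. \<gamma> = mat2_mult \<delta> \<rho>"
    using Gamma0_finite_index[OF N] by blast
  have "(1, 0, 0, 1) \<in> SL2Z" by (simp add: SL2Z_def)
  hence "R \<noteq> {}" using R(3) by blast
  define X where "X = (\<lambda>\<rho>. \<Psi> (moebius \<rho> (\<sigma> \<rho>))) ` R"
  have "finite X" "X \<noteq> {}"
    using R(1) \<open>R \<noteq> {}\<close> by (auto simp: X_def)
  from Min_in[OF this] obtain \<rho>0 where \<rho>0: "\<rho>0 \<in> R" "Min X = \<Psi> (moebius \<rho>0 (\<sigma> \<rho>0))"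
    by (auto simp: X_def)
  show ?thesis
  proof (rule weighted_minimum_imp_constant[OF G w])
    show "moebius \<rho>0 (\<sigma> \<rho>0) \<in> upper_half_plane"
    proof -
      have "\<rho>0 \<in> SL2Z" using \<rho>0(1) R(2) by blast
      thus ?thesis
        using \<sigma>(1)[of \<rho>0] by (intro moebius_in_upper_half_plane upper_half_planeI) simp_all
    qed
    fix \<tau> assume "\<tau> \<in> upper_half_plane"
    then obtain \<gamma> \<tau>' where \<gamma>: "\<gamma> \<in> SL2Z" "Im \<tau>' \<ge> 1 / 2" "\<tau> = moebius \<gamma> \<tau>'"
      using moebius_reduction by blast
    obtain \<delta> \<rho> where \<delta>: "\<delta> \<in> Gamma0 N" "\<rho> \<in> R" "\<gamma> = mat2_mult \<delta> \<rho>"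
      using R(3)[OF \<gamma>(1)] by blast
    have \<rho>: "\<rho> \<in> SL2Z" using \<delta>(2) R(2) by blast
    have \<tau>': "\<tau>' \<in> upper_half_plane" using \<gamma>(2) by (simp add: upper_half_plane_def)
    have "\<tau> = moebius \<delta> (moebius \<rho> \<tau>')"
      unfolding \<gamma>(3) \<delta>(3) by (rule moebius_mat2_mult[OF Gamma0_subset_SL2Z[OF \<delta>(1)] \<rho> \<tau>'])
    hence "\<Psi> \<tau> = \<Psi> (moebius \<rho> \<tau>')"
      using inv[OF \<delta>(1) moebius_in_upper_half_plane[OF \<rho> \<tau>']] by (simp add: \<Psi>_def)
    moreover have "\<Psi> (moebius \<rho> (\<sigma> \<rho>)) \<le> \<Psi> (moebius \<rho> \<tau>')"
      by (rule \<sigma>(2)[OF \<rho> \<gamma>(2)])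
    moreover have "Min X \<le> \<Psi> (moebius \<rho> (\<sigma> \<rho>))"
      using \<open>finite X\<close> \<delta>(2) by (intro Min_le) (auto simp: X_def)
    ultimately show "ln (norm (G (moebius \<rho>0 (\<sigma> \<rho>0)))) + w * ln (Im (moebius \<rho>0 (\<sigma> \<rho>0))) \<le>
        ln (norm (G \<tau>)) + w * ln (Im \<tau>)"
      using \<rho>0(2) by (simp add: \<Psi>_def)
  qed
qed

lemma rigidity:
  fixes G :: "complex \<Rightarrow> complex" and w :: real
  assumes N: "N > 0"
    and G: "G holomorphic_on upper_half_plane" "\<And>\<tau>. \<tau> \<in> upper_half_plane \<Longrightarrow> G \<tau> \<noteq> 0"
    and inv: "\<And>\<gamma> \<tau>. \<gamma> \<in> Gamma0 N \<Longrightarrow> \<tau> \<in> upper_half_plane \<Longrightarrow>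
      ln (norm (G (moebius \<gamma> \<tau>))) + w * ln (Im (moebius \<gamma> \<tau>)) = ln (norm (G \<tau>)) + w * ln (Im \<tau>)"
    and cusp: "\<And>\<gamma>. \<gamma> \<in> SL2Z \<Longrightarrow> \<exists>C Y. \<forall>\<tau>. Im \<tau> > 0 \<and> Im \<tau> \<ge> Y \<longrightarrow>
      \<bar>ln (norm (G (moebius \<gamma> \<tau>))) + w * ln (Im (moebius \<gamma> \<tau>)) - w * ln (Im \<tau>)\<bar> \<le> C"
  shows "G constant_on upper_half_plane"
proof (cases "w \<ge> 0")
  case True
  show ?thesis by (rule rigidity_nonneg[OF N G True inv cusp])
next
  case False
  have ln_inv: "ln (norm (inverse (G \<tau>))) = - ln (norm (G \<tau>))" if "\<tau> \<in> upper_half_plane" for \<tau>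
    using G(2)[OF that] by (simp add: norm_inverse ln_inverse)
  have "(\<lambda>\<tau>. inverse (G \<tau>)) constant_on upper_half_plane"
  proof (rule rigidity_nonneg[OF N, where w = "- w"])
    show "(\<lambda>\<tau>. inverse (G \<tau>)) holomorphic_on upper_half_plane"
      using G by (intro holomorphic_intros)
    show "ln (norm (inverse (G (moebius \<gamma> \<tau>)))) + - w * ln (Im (moebius \<gamma> \<tau>)) =
        ln (norm (inverse (G \<tau>))) + - w * ln (Im \<tau>)"
      if "\<gamma> \<in> Gamma0 N" "\<tau> \<in> upper_half_plane" for \<gamma> \<tau>
      using inv[OF that] ln_inv[OF that(2)]
        ln_inv[OF moebius_in_upper_half_plane[OF Gamma0_subset_SL2Z[OF that(1)] that(2)]] by simp
    fix \<gamma> assume \<gamma>: "\<gamma> \<in> SL2Z"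
    obtain C Y where CY: "\<And>\<tau>. Im \<tau> > 0 \<Longrightarrow> Im \<tau> \<ge> Y \<Longrightarrow>
      \<bar>ln (norm (G (moebius \<gamma> \<tau>))) + w * ln (Im (moebius \<gamma> \<tau>)) - w * ln (Im \<tau>)\<bar> \<le> C"
      using cusp[OF \<gamma>] by blast
    show "\<exists>C Y. \<forall>\<tau>. Im \<tau> > 0 \<and> Im \<tau> \<ge> Y \<longrightarrow>
      \<bar>ln (norm (inverse (G (moebius \<gamma> \<tau>)))) + - w * ln (Im (moebius \<gamma> \<tau>)) - - w * ln (Im \<tau>)\<bar> \<le> C"
    proof (intro exI allI impI)
      fix \<tau> assume \<tau>: "Im \<tau> > 0 \<and> Im \<tau> \<ge> Y"
      hence "ln (norm (inverse (G (moebius \<gamma> \<tau>)))) = - ln (norm (G (moebius \<gamma> \<tau>)))"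
        by (intro ln_inv moebius_in_upper_half_plane[OF \<gamma>] upper_half_planeI) auto
      thus "\<bar>ln (norm (inverse (G (moebius \<gamma> \<tau>)))) + - w * ln (Im (moebius \<gamma> \<tau>)) - - w * ln (Im \<tau>)\<bar> \<le> C"
        using CY[of \<tau>] \<tau> by simp
    qed
  qed (use G False in auto)
  then obtain c where "\<And>\<tau>. \<tau> \<in> upper_half_plane \<Longrightarrow> inverse (G \<tau>) = c"
    by (auto simp: constant_on_def)
  hence "G \<tau> = inverse c" if "\<tau> \<in> upper_half_plane" for \<tau>
    using that by (metis inverse_inverse_eq)
  thus ?thesis by (auto simp: constant_on_def)
qed

section \<open>Cuspidal divisors\<close>

text \<open>Conjugation by the diagonal matrix with entries \<open>t\<close> and 1 turns
  \<open>\<gamma>\<close> into \<open>(a, t b, c / t, d)\<close>, which is integral because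
  \<open>t\<close> divides \<open>N\<close> and \<open>N\<close> divides \<open>c\<close>.\<close>

lemma eta_height_level:
  assumes "\<gamma> \<in> Gamma0 N" "t dvd N" "t > 0" "\<tau> \<in> upper_half_plane"
  shows "eta_height (of_nat t * moebius \<gamma> \<tau>) = eta_height (of_nat t * \<tau>)"
proof -
  obtain a b c d where g: "\<gamma> = (a, b, c, d)" by (cases \<gamma>) auto
  have det: "a * d - b * c = 1" and "int N dvd c"
    using assms(1) by (auto simp: g Gamma0_def SL2Z_def)
  moreover have "int t dvd int N" using assms(2) by simp
  ultimately obtain e where e: "c = int t * e" by (meson dvdE dvd_trans)
  have "(a, int t * b, e, d) \<in> SL2Z"
    using det by (simp add: SL2Z_def e algebra_simps)
  moreover have "of_nat t * \<tau> \<in> upper_half_plane"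
    using assms(3,4) by (simp add: upper_half_plane_def)
  moreover have "of_nat t * moebius \<gamma> \<tau> = moebius (a, int t * b, e, d) (of_nat t * \<tau>)"
    by (simp add: g e algebra_simps)
  ultimately show ?thesis
    by (metis eta_height_moebius)
qed

lemma norm_eta_powr_of_real:
  assumes "\<tau> \<in> upper_half_plane"
  shows "norm (eta_powr (of_real a) \<tau>) = exp (a * Re (ln_eta \<tau>))"
  by (simp add: eta_powr_eq_exp[OF assms])

lemma ln_norm_modular_invariant:
  assumes "meromorphic_modular N k f" "cuspidal_divisor f" "\<gamma> \<in> Gamma0 N" "\<tau> \<in> upper_half_plane"
  shows "ln (norm (f (moebius \<gamma> \<tau>))) + k / 2 * ln (Im (moebius \<gamma> \<tau>)) =
         ln (norm (f \<tau>)) + k / 2 * ln (Im \<tau>)"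
proof -
  have \<gamma>: "\<gamma> \<in> SL2Z" using assms(3) by (rule Gamma0_subset_SL2Z)
  define j where "j = norm (automorphy \<gamma> \<tau>)"
  have j: "j > 0" using automorphy_nonzero[OF \<gamma> assms(4)] by (simp add: j_def)
  have "f \<tau> \<noteq> 0" using assms(2,4) by (simp add: cuspidal_divisor_def)
  moreover have "norm (f (moebius \<gamma> \<tau>)) = j powr of_int k * norm (f \<tau>)"
    using assms(1,3,4) j
    by (simp add: meromorphic_modular_def norm_mult norm_power_int j_def powr_real_of_int')
  ultimately have "ln (norm (f (moebius \<gamma> \<tau>))) = k * ln j + ln (norm (f \<tau>))"
    using j by (simp add: ln_mult ln_powr)
  moreover have im: "ln (Im (moebius \<gamma> \<tau>)) = ln (Im \<tau>) - 2 * ln j"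
    unfolding Im_moebius[OF \<gamma> assms(4)] j_def[symmetric]
    using j upper_half_planeD[OF assms(4)] by (simp add: ln_div ln_realpow)
  ultimately show ?thesis
    unfolding im by (simp add: algebra_simps)
qed

text \<open>The slope \<open>\<mu>\<close> is the order at the cusp in disguise: for order
  \<open>m\<close> in \<open>z = exp (2 pi i \<tau> / N)\<close> it is \<open>- 2 pi m / N\<close>,
  because \<open>ln \<bar>z\<bar> = - 2 pi Im \<tau> / N\<close>. The automorphy factor cancels
  against the change of \<open>Im \<tau>\<close>.\<close>

lemma modular_cusp_growth:
  assumes "meromorphic_modular N k f" "cuspidal_divisor f" "\<gamma> \<in> SL2Z" "N > 0"
  shows "\<exists>\<mu> C Y. \<forall>\<tau>. Im \<tau> > 0 \<and> Im \<tau> \<ge> Y \<longrightarrow>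
    \<bar>ln (norm (f (moebius \<gamma> \<tau>))) + k / 2 * ln (Im (moebius \<gamma> \<tau>)) - (k / 2 * ln (Im \<tau>) + \<mu> * Im \<tau>)\<bar> \<le> C"
proof -
  define z where "z = (\<lambda>\<tau>. exp (2 * of_real pi * \<i> * \<tau> / of_nat N))"
  obtain g y0 where g: "g meromorphic_on {0}"
    "\<And>\<tau>. \<tau> \<in> upper_half_plane \<Longrightarrow> Im \<tau> > y0 \<Longrightarrow> slash k f \<gamma> \<tau> = g (z \<tau>)"
    using assms(1,3) unfolding meromorphic_modular_def meromorphic_at_cusps_def z_def by blast
  have fnz: "f (moebius \<gamma> \<tau>) \<noteq> 0" if "\<tau> \<in> upper_half_plane" for \<tau>
    using assms(2) moebius_in_upper_half_plane[OF assms(3) that] by (simp add: cuspidal_divisor_def)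
  have slash_nz: "slash k f \<gamma> \<tau> \<noteq> 0" if "\<tau> \<in> upper_half_plane" for \<tau>
    using fnz[OF that] automorphy_nonzero[OF assms(3) that] by (simp add: slash_def)
  have norm_z: "norm (z \<tau>) = exp (- (2 * pi * Im \<tau> / N))" for \<tau>
    by (simp add: z_def)
  have small: "norm (z \<tau>) \<le> r" if "r > 0" "Im \<tau> \<ge> - (N / (2 * pi) * ln r)" for r \<tau>
  proof -
    have "- (2 * pi * Im \<tau> / N) \<le> ln r"
      using that(2) assms(4) by (simp add: field_simps)
    thus ?thesis
      unfolding norm_z using that(1) by (metis exp_le_cancel_iff exp_ln)
  qed
  \<comment> \<open>The order of \<open>g\<close> makes sense only if \<open>g\<close> does not
    vanish near 0. High points of the imaginary axis give arguments \<open>z \<tau>\<close> as close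
    to 0 as desired, where the nonvanishing of \<open>f\<close> is inherited.\<close>
  have freq: "\<exists>\<^sub>F w in at 0. g w \<noteq> 0"
    unfolding frequently_at
  proof (intro allI impI)
    fix d :: real assume d: "d > 0"
    define \<tau> where "\<tau> = Complex 0 (max (max 1 (y0 + 1)) (- (N / (2 * pi) * ln (d / 2))))"
    have \<tau>: "\<tau> \<in> upper_half_plane" "Im \<tau> > y0"
      by (auto simp: \<tau>_def upper_half_plane_def)
    have "norm (z \<tau>) \<le> d / 2"
      using d by (intro small) (auto simp: \<tau>_def)
    thus "\<exists>x\<in>UNIV. x \<noteq> 0 \<and> dist x 0 < d \<and> g x \<noteq> 0"
      using d g(2)[OF \<tau>] slash_nz[OF \<tau>(1)] by (intro bexI[of _ "z \<tau>"]) (auto simp: z_def)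
  qed
  obtain m :: int and C r :: real where r: "r > 0" and
    mC: "\<And>w. w \<noteq> 0 \<Longrightarrow> norm w \<le> r \<Longrightarrow> \<bar>ln (norm (g w)) - of_int m * ln (norm w)\<bar> \<le> C"
    using meromorphic_log_growth[OF g(1) freq] by metis
  show ?thesis
  proof (intro exI allI impI)
    fix \<tau> assume \<tau>: "Im \<tau> > 0 \<and> Im \<tau> \<ge> max (y0 + 1) (- (N / (2 * pi) * ln r))"
    have H: "\<tau> \<in> upper_half_plane" using \<tau> by (simp add: upper_half_plane_def)
    define j where "j = norm (automorphy \<gamma> \<tau>)"
    have j: "j > 0" using automorphy_nonzero[OF assms(3) H] by (simp add: j_def)
    have "slash k f \<gamma> \<tau> = g (z \<tau>)"
      using \<tau> by (intro g(2) H) linarith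
    moreover have "norm (slash k f \<gamma> \<tau>) = j powr of_int (- k) * norm (f (moebius \<gamma> \<tau>))"
      using j unfolding slash_def norm_mult norm_power_int j_def
      by (subst powr_real_of_int') auto
    ultimately have "ln (norm (g (z \<tau>))) = ln (j powr of_int (- k) * norm (f (moebius \<gamma> \<tau>)))"
      by simp
    also have "\<dots> = - k * ln j + ln (norm (f (moebius \<gamma> \<tau>)))"
      using j fnz[OF H] by (simp add: ln_mult ln_powr)
    finally have lng: "ln (norm (f (moebius \<gamma> \<tau>))) = ln (norm (g (z \<tau>))) + k * ln j"
      by simp
    have im: "ln (Im (moebius \<gamma> \<tau>)) = ln (Im \<tau>) - 2 * ln j"
      unfolding Im_moebius[OF assms(3) H] j_def[symmetric]
      using j upper_half_planeD[OF H] by (simp add: ln_div ln_realpow)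
    have "\<bar>ln (norm (g (z \<tau>))) - of_int m * ln (norm (z \<tau>))\<bar> \<le> C"
      using \<tau> by (intro mC small r) (auto simp: z_def)
    also have "ln (norm (g (z \<tau>))) - of_int m * ln (norm (z \<tau>)) =
        ln (norm (f (moebius \<gamma> \<tau>))) + k / 2 * ln (Im (moebius \<gamma> \<tau>)) -
        (k / 2 * ln (Im \<tau>) + (- (2 * pi * m / N)) * Im \<tau>)"
      unfolding lng im norm_z by (simp add: algebra_simps)
    finally show "\<bar>ln (norm (f (moebius \<gamma> \<tau>))) + k / 2 * ln (Im (moebius \<gamma> \<tau>)) -
        (k / 2 * ln (Im \<tau>) + (- (2 * pi * m / N)) * Im \<tau>)\<bar> \<le> C" .
  qed
qed

theorem theorem3:
  fixes N M :: nat and k :: int and f :: "complex \<Rightarrow> complex"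
  assumes "odd M" and "squarefree M"
    and "N = 4 * M \<or> N = 8 * M"
    and "meromorphic_modular N k f"
    and "cuspidal_divisor f"
  shows "eta_quotient N f"
proof -
  have N: "N > 0" using assms(1,3) by (auto intro: Nat.gr0I)
  define F where "F = (\<lambda>\<tau>. ln (norm (f \<tau>)) + k / 2 * ln (Im \<tau>))"
  have F_inv: "F (moebius \<gamma> \<tau>) = F \<tau>" if "\<gamma> \<in> Gamma0 N" "\<tau> \<in> upper_half_plane" for \<gamma> \<tau>
    unfolding F_def by (rule ln_norm_modular_invariant[OF assms(4,5) that])
  obtain \<mu> C Y where growth: "\<And>\<gamma> \<tau>. \<gamma> \<in> SL2Z \<Longrightarrow> Im \<tau> > 0 \<Longrightarrow> Im \<tau> \<ge> Y \<gamma> \<Longrightarrow>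
      \<bar>F (moebius \<gamma> \<tau>) - (k / 2 * ln (Im \<tau>) + \<mu> \<gamma> * Im \<tau>)\<bar> \<le> C \<gamma>"
    using modular_cusp_growth[OF assms(4,5) _ N] unfolding F_def by metis
  \<comment> \<open>Takes \<open>i \<infinity>\<close> to the cusp \<open>1/e\<close>; with
    \<open>e\<close> running through the divisors of \<open>N\<close>, these represent all
    cusps.\<close>
  define cusp_matrix where "cusp_matrix = (\<lambda>e :: nat. (1 :: int, 0 :: int, int e, 1 :: int))"
  have cusp_SL2Z: "cusp_matrix e \<in> SL2Z" for e
    by (simp add: cusp_matrix_def SL2Z_def)
  \<comment> \<open>The height of \<open>\<eta>(t \<tau>)\<close> has slope
    \<open>- pi gcd(t, e)\<^sup>2 / (12 t)\<close> at the cusp \<open>1/e\<close>. With exponents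
    \<open>a t = t * x t\<close> the denominators disappear, and equality of the total slope with
    \<open>\<mu>\<close> is this system.\<close>
  obtain x where x: "\<And>e. e dvd N \<Longrightarrow>
      (\<Sum>t | t dvd N. x t * (real (gcd t e))\<^sup>2) = - (12 / pi) * \<mu> (cusp_matrix e)"
    using gcd_square_system_solvable[OF N, of "\<lambda>e. - (12 / pi) * \<mu> (cusp_matrix e)"] by blast
  define a where "a = (\<lambda>t. real t * x t)"
  define P where "P = (\<lambda>\<tau>. \<Prod>t | t dvd N. V_op t (eta_powr (of_real (a t))) \<tau>)"
  define G where "G = (\<lambda>\<tau>. f \<tau> / P \<tau>)"
  define w where "w = k / 2 - (\<Sum>t | t dvd N. a t) / 4"
  \<comment> \<open>The constant that arises from
    \<open>ln (Im (t \<tau>)) = ln t + ln (Im \<tau>)\<close>.\<close>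
  define c0 where "c0 = (\<Sum>t | t dvd N. a t * ln t) / 4"
  have tpos: "t > 0" if "t dvd N" for t
    using that N by (rule dvd_pos_nat[rotated])
  have tH: "of_nat t * \<tau> \<in> upper_half_plane" if "t dvd N" "\<tau> \<in> upper_half_plane" for t \<tau>
    using tpos[OF that(1)] that(2) by (simp add: upper_half_plane_def)
  have Pnz: "P \<tau> \<noteq> 0" if "\<tau> \<in> upper_half_plane" for \<tau>
    unfolding P_def V_op_def using tH that N by (auto simp: eta_powr_eq_exp)
  have fnz: "f \<tau> \<noteq> 0" if "\<tau> \<in> upper_half_plane" for \<tau>
    using assms(5) that by (simp add: cuspidal_divisor_def)
  have Gnz: "G \<tau> \<noteq> 0" if "\<tau> \<in> upper_half_plane" for \<tau>
    using fnz Pnz that by (simp add: G_def)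
  have "f analytic_on upper_half_plane"
    using assms(4,5) by (intro nicely_meromorphic_without_singularities)
      (auto simp: meromorphic_modular_def cuspidal_divisor_def)
  hence "f holomorphic_on upper_half_plane"
    by (rule analytic_imp_holomorphic)
  moreover have "P holomorphic_on upper_half_plane"
    unfolding P_def V_op_def
    by (intro holomorphic_intros holomorphic_on_compose_gen[OF _ holomorphic_eta_powr, unfolded o_def])
       (use tH in auto)
  ultimately have holG: "G holomorphic_on upper_half_plane"
    unfolding G_def using Pnz by (intro holomorphic_intros)
  have \<Psi>: "ln (norm (G \<tau>)) + w * ln (Im \<tau>) =
      F \<tau> - (\<Sum>t | t dvd N. a t * eta_height (of_nat t * \<tau>)) + c0" if \<tau>: "\<tau> \<in> upper_half_plane" for \<tau>
  proof -
    have Im: "Im \<tau> > 0" using \<tau> by (rule upper_half_planeD)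
    have "norm (P \<tau>) = exp (\<Sum>t | t dvd N. a t * Re (ln_eta (of_nat t * \<tau>)))"
      unfolding P_def V_op_def prod_norm[symmetric] using N
      by (subst exp_sum) (auto intro!: prod.cong norm_eta_powr_of_real tH \<tau>)
    hence "ln (norm (G \<tau>)) = ln (norm (f \<tau>)) - (\<Sum>t | t dvd N. a t * Re (ln_eta (of_nat t * \<tau>)))"
      using fnz[OF \<tau>] by (simp add: G_def norm_divide ln_div)
    moreover have "(\<Sum>t | t dvd N. a t * eta_height (of_nat t * \<tau>)) =
        (\<Sum>t | t dvd N. a t * Re (ln_eta (of_nat t * \<tau>))) + c0 + (\<Sum>t | t dvd N. a t) / 4 * ln (Im \<tau>)"
    proof -
      have "(\<Sum>t | t dvd N. a t * eta_height (of_nat t * \<tau>)) =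
          (\<Sum>t | t dvd N. a t * Re (ln_eta (of_nat t * \<tau>)) + a t * ln t / 4 + a t * (ln (Im \<tau>) / 4))"
        using Im tpos by (intro sum.cong refl) (simp add: eta_height_def ln_mult field_simps)
      thus ?thesis
        by (simp add: sum.distrib c0_def flip: sum_divide_distrib sum_distrib_right)
    qed
    ultimately show ?thesis
      by (simp add: F_def w_def algebra_simps)
  qed
  have "G constant_on upper_half_plane"
  proof (rule rigidity[OF N holG Gnz, where w = w])
    fix \<gamma> \<tau> assume \<gamma>: "\<gamma> \<in> Gamma0 N" and \<tau>: "\<tau> \<in> upper_half_plane"
    have "(\<Sum>t | t dvd N. a t * eta_height (of_nat t * moebius \<gamma> \<tau>)) =
        (\<Sum>t | t dvd N. a t * eta_height (of_nat t * \<tau>))"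
      using tpos by (intro sum.cong refl) (simp add: eta_height_level[OF \<gamma> _ _ \<tau>])
    thus "ln (norm (G (moebius \<gamma> \<tau>))) + w * ln (Im (moebius \<gamma> \<tau>)) = ln (norm (G \<tau>)) + w * ln (Im \<tau>)"
      using \<Psi>[OF \<tau>] \<Psi>[OF moebius_in_upper_half_plane[OF Gamma0_subset_SL2Z[OF \<gamma>] \<tau>]] F_inv[OF \<gamma> \<tau>]
      by simp
  next
    fix \<gamma> :: int_mat2 assume \<gamma>: "\<gamma> \<in> SL2Z"
    obtain p q r s where g: "\<gamma> = (p, q, r, s)" by (cases \<gamma>) auto
    have det: "p * s - q * r = 1" using \<gamma> by (simp add: g SL2Z_def)
    \<comment> \<open>The divisor that labels the cusp of \<open>\<gamma>\<close>: \<open>r\<close>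
      and \<open>e\<close> have the same gcd with \<open>N\<close>, as
      \<open>cusp_equivalence\<close> requires.\<close>
    define e where "e = nat (gcd r (int N))"
    have e: "int e = gcd r (int N)" by (simp add: e_def)
    have "int e dvd int N" by (simp add: e)
    hence eN: "e dvd N" by simp
    obtain n where n: "int N dvd r * 1 - (s + n * r) * int e"
      by (rule cusp_equivalence[OF assms(1,2,3), of 1 1 0 "int e" p s q r]) (use det e in auto)
    \<comment> \<open>The growth of \<open>F\<close> along \<open>\<gamma>\<close> is thus that at
      the cusp \<open>1/e\<close>, where the exponents were fitted; the real translation by
      \<open>n\<close> leaves \<open>Im \<tau>\<close> unchanged.\<close>
    have F\<gamma>: "F (moebius \<gamma> \<tau>) = F (moebius (cusp_matrix e) (\<tau> - of_int n))" if \<tau>: "\<tau> \<in> upper_half_plane" for \<tau>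
    proof -
      define T where "T = (1 :: int, n, 0 :: int, 1 :: int)"
      define \<tau>' where "\<tau>' = \<tau> - of_int n"
      have \<tau>': "\<tau>' \<in> upper_half_plane" using \<tau> by (simp add: \<tau>'_def upper_half_plane_def)
      have T: "T \<in> SL2Z" by (simp add: T_def SL2Z_def)
      define \<delta> where "\<delta> = mat2_mult (mat2_mult \<gamma> T) (1, 0, - int e, 1)"
      have "\<delta> \<in> SL2Z"
        unfolding \<delta>_def by (intro mat2_mult_in_SL2Z \<gamma> T) (simp add: SL2Z_def)
      hence \<delta>: "\<delta> \<in> Gamma0 N"
        using n by (simp add: Gamma0_def \<delta>_def g T_def algebra_simps)
      have "mat2_mult \<gamma> T = mat2_mult \<delta> (cusp_matrix e)"
        by (simp add: \<delta>_def g T_def cusp_matrix_def algebra_simps)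
      moreover have "\<tau> = moebius T \<tau>'" by (simp add: T_def \<tau>'_def)
      ultimately have "moebius \<gamma> \<tau> = moebius \<delta> (moebius (cusp_matrix e) \<tau>')"
        using moebius_mat2_mult[OF \<gamma> T \<tau>']
          moebius_mat2_mult[OF Gamma0_subset_SL2Z[OF \<delta>] cusp_SL2Z \<tau>'] by simp
      thus ?thesis
        using F_inv[OF \<delta> moebius_in_upper_half_plane[OF cusp_SL2Z \<tau>']] by (simp add: \<tau>'_def)
    qed
    have "\<exists>D. \<forall>\<tau>. Im \<tau> \<ge> t \<longrightarrow> \<bar>eta_height (of_nat t * moebius \<gamma> \<tau>) -
        (ln (Im \<tau>) / 4 - pi * (real (gcd t e))\<^sup>2 / (12 * t) * Im \<tau>)\<bar> \<le> D" if "t dvd N" for t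
    proof -
      have "gcd (int t) r = gcd (int t) (gcd r (int N))"
      proof -
        have "gcd (int t) (int N) = int t"
          using that by (simp add: gcd_nat.absorb1)
        thus ?thesis
          by (metis gcd.assoc gcd.commute)
      qed
      also have "\<dots> = int (gcd t e)" by (simp flip: e)
      finally have "real_of_int (gcd (int t) r) = real (gcd t e)" by simp
      with eta_height_cusp[OF tpos[OF that], of p q r s] show ?thesis
        using \<gamma> unfolding g by metis
    qed
    then obtain D where D: "\<And>t \<tau>. t dvd N \<Longrightarrow> Im \<tau> \<ge> t \<Longrightarrow> \<bar>eta_height (of_nat t * moebius \<gamma> \<tau>) -
        (ln (Im \<tau>) / 4 - pi * (real (gcd t e))\<^sup>2 / (12 * t) * Im \<tau>)\<bar> \<le> D t"
      by metis
    show "\<exists>C Y. \<forall>\<tau>. Im \<tau> > 0 \<and> Im \<tau> \<ge> Y \<longrightarrow>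
      \<bar>ln (norm (G (moebius \<gamma> \<tau>))) + w * ln (Im (moebius \<gamma> \<tau>)) - w * ln (Im \<tau>)\<bar> \<le> C"
    proof (intro exI allI impI)
      fix \<tau> assume \<tau>: "Im \<tau> > 0 \<and> Im \<tau> \<ge> max N (Y (cusp_matrix e))"
      have H: "\<tau> \<in> upper_half_plane" using \<tau> by (simp add: upper_half_plane_def)
      define \<nu> where "\<nu> = \<mu> (cusp_matrix e)"
      define S where "S = (\<Sum>t | t dvd N. a t * eta_height (of_nat t * moebius \<gamma> \<tau>))"
      have 1: "\<bar>F (moebius \<gamma> \<tau>) - (k / 2 * ln (Im \<tau>) + \<nu> * Im \<tau>)\<bar> \<le> C (cusp_matrix e)"
        using growth[OF cusp_SL2Z, of "\<tau> - of_int n" e] \<tau> by (simp add: F\<gamma>[OF H] \<nu>_def)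
      have "(\<Sum>t | t dvd N. a t * (ln (Im \<tau>) / 4 - pi * (real (gcd t e))\<^sup>2 / (12 * t) * Im \<tau>)) =
          (\<Sum>t | t dvd N. a t * (ln (Im \<tau>) / 4) - x t * (real (gcd t e))\<^sup>2 * (pi / 12 * Im \<tau>))"
        using tpos by (intro sum.cong refl) (simp add: a_def field_simps)
      \<comment> \<open>The equation solved by \<open>x\<close> turns the total slope into
        \<open>\<nu>\<close>, the slope of \<open>F\<close>. The linear terms therefore cancel in
        \<open>G\<close>, and only \<open>w * ln (Im \<tau>)\<close> and bounded terms
        remain.\<close>
      also have "\<dots> = (\<Sum>t | t dvd N. a t) * (ln (Im \<tau>) / 4) + \<nu> * Im \<tau>"
        unfolding sum_subtractf sum_distrib_right[symmetric] x[OF eN] \<nu>_def by simp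
      finally have main: "(\<Sum>t | t dvd N. a t * (ln (Im \<tau>) / 4 - pi * (real (gcd t e))\<^sup>2 / (12 * t) * Im \<tau>)) = \<dots>" .
      have "\<bar>S - ((\<Sum>t | t dvd N. a t) * (ln (Im \<tau>) / 4) + \<nu> * Im \<tau>)\<bar> =
          \<bar>\<Sum>t | t dvd N. a t * (eta_height (of_nat t * moebius \<gamma> \<tau>) -
            (ln (Im \<tau>) / 4 - pi * (real (gcd t e))\<^sup>2 / (12 * t) * Im \<tau>))\<bar>"
        unfolding main[symmetric] S_def by (simp add: right_diff_distrib flip: sum_subtractf)
      also have "\<dots> \<le> (\<Sum>t | t dvd N. \<bar>a t\<bar> * D t)"
      proof (rule order_trans[OF sum_abs], rule sum_mono)
        fix t assume "t \<in> {t. t dvd N}"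
        hence t: "t dvd N" by simp
        hence "real t \<le> Im \<tau>" using \<tau> dvd_imp_le[OF t N] by linarith
        thus "\<bar>a t * (eta_height (of_nat t * moebius \<gamma> \<tau>) -
            (ln (Im \<tau>) / 4 - pi * (real (gcd t e))\<^sup>2 / (12 * t) * Im \<tau>))\<bar> \<le> \<bar>a t\<bar> * D t"
          unfolding abs_mult by (intro mult_left_mono D t) auto
      qed
      finally have 2: "\<bar>S - ((\<Sum>t | t dvd N. a t) * (ln (Im \<tau>) / 4) + \<nu> * Im \<tau>)\<bar> \<le> (\<Sum>t | t dvd N. \<bar>a t\<bar> * D t)" .
      have "ln (norm (G (moebius \<gamma> \<tau>))) + w * ln (Im (moebius \<gamma> \<tau>)) = F (moebius \<gamma> \<tau>) - S + c0"
        unfolding S_def by (rule \<Psi>[OF moebius_in_upper_half_plane[OF \<gamma> H]])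
      hence "ln (norm (G (moebius \<gamma> \<tau>))) + w * ln (Im (moebius \<gamma> \<tau>)) - w * ln (Im \<tau>) =
          (F (moebius \<gamma> \<tau>) - (k / 2 * ln (Im \<tau>) + \<nu> * Im \<tau>)) -
          (S - ((\<Sum>t | t dvd N. a t) * (ln (Im \<tau>) / 4) + \<nu> * Im \<tau>)) + c0"
        by (simp add: w_def algebra_simps)
      thus "\<bar>ln (norm (G (moebius \<gamma> \<tau>))) + w * ln (Im (moebius \<gamma> \<tau>)) - w * ln (Im \<tau>)\<bar> \<le>
          C (cusp_matrix e) + (\<Sum>t | t dvd N. \<bar>a t\<bar> * D t) + \<bar>c0\<bar>"
        using 1 2 by linarith
    qed
  qed
  then obtain c where c: "\<And>\<tau>. \<tau> \<in> upper_half_plane \<Longrightarrow> G \<tau> = c"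
    by (auto simp: constant_on_def)
  have "f \<tau> = c * P \<tau>" if "\<tau> \<in> upper_half_plane" for \<tau>
    using c[OF that] Pnz[OF that] by (simp add: G_def field_simps)
  thus ?thesis
    unfolding eta_quotient_def P_def by (intro exI[of _ c] exI[of _ "\<lambda>t. of_real (a t)"]) auto
qed

end
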